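(* Let $\mathcal{E}$ be a finite biordered set. Then any Schützenberger group of $\mathsf{IG}(\mathcal{E})$ (that is, the Schützenberger group of any $\mathscr{H}$-class of $\mathsf{IG}(\mathcal{E})$) is a divisor of some maximal subgroup of $\mathsf{IG}(\mathcal{E})$.
   Context: For a semigroup $S$ with set of idempotents $E(S)$, $\mathcal{E}_S$ is the partial algebra on $E(S)$ retaining the product $ef$ exactly when $\{ef,fe\}\cap\{e,f\}\neq\varnothing$ (then both $ef,fe$ are idempotents, and $\{e,f\}$ is called a basic pair). A biordered set is a partial algebra $\mathcal{E}=(E,\cdot)$ isomorphic to some $\mathcal{E}_S$. The free idempotent generated semigroup is $\mathsf{IG}(\mathcal{E})=\langle \overline{E}\mid \overline{e}\,\overline{f}=\overline{e\cdot f}\text{ whenever }\{e,f\}\text{ is a basic pair in }\mathcal{E}\rangle$, $\overline E=\{\overline e:e\in E\}$. For an $\mathscr{H}$-class $H$ of a semigroup $S$, let $\mathrm{Stab}(H)=\{s\in S^1: Hs\subseteq H\}$; for $s\in\mathrm{Stab}(H)$ the map $\rho_s:h\mapsto hs$ is a permutation of $H$, and $\Gamma_H=\{\rho_s: s\in\mathrm{Stab}(H)\}$ is a group of permutations, the (right) Schützenberger group of $H$. Maximal subgroups of a semigroup are the $\mathscr{H}$-classes of its idempotents. A divisor of a group $G$ is a (group isomorphic to a) quotient of a subgroup of $G$. *)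

theory Defs
  imports "HOL-Algebra.Coset"
begin

record 'a sgrp = "'a partial_object" +
  sprod :: "'a \<Rightarrow> 'a \<Rightarrow> 'a" (infixl "\<cdot>\<index>" 70)

locale sgrp =
  fixes S :: "('a, 'm) sgrp_scheme" (structure)
  assumes closed: "\<lbrakk>x \<in> carrier S; y \<in> carrier S\<rbrakk> \<Longrightarrow> x \<cdot> y \<in> carrier S"
    and assoc: "\<lbrakk>x \<in> carrier S; y \<in> carrier S; z \<in> carrier S\<rbrakk>
      \<Longrightarrow> (x \<cdot> y) \<cdot> z = x \<cdot> (y \<cdot> z)"

definition idempotents :: "('a, 'm) sgrp_scheme \<Rightarrow> 'a set" where
  "idempotents S = {e \<in> carrier S. e \<cdot>\<^bsub>S\<^esub> e = e}"

definition has_identity :: "('a, 'm) sgrp_scheme \<Rightarrow> bool" where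
  "has_identity S \<longleftrightarrow>
    (\<exists>u \<in> carrier S. \<forall>x \<in> carrier S. u \<cdot>\<^bsub>S\<^esub> x = x \<and> x \<cdot>\<^bsub>S\<^esub> u = x)"

text \<open>The elements of \<open>S\<^sup>1\<close>: \<open>Some s\<close> stands for \<open>s \<in> S\<close>, and \<open>None\<close> for the
  identity adjoined when \<open>S\<close> has none.\<close>

definition carrier1 :: "('a, 'm) sgrp_scheme \<Rightarrow> 'a option set" where
  "carrier1 S = Some ` carrier S \<union> (if has_identity S then {} else {None})"

text \<open>The products \<open>s x\<close> and \<open>x s\<close> in \<open>S\<^sup>1\<close> for \<open>s \<in> S\<^sup>1\<close> and \<open>x \<in> S\<close>; they lie in \<open>S\<close>.\<close>

definition lmult1 :: "('a, 'm) sgrp_scheme \<Rightarrow> 'a option \<Rightarrow> 'a \<Rightarrow> 'a" where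
  "lmult1 S s x = (case s of None \<Rightarrow> x | Some t \<Rightarrow> t \<cdot>\<^bsub>S\<^esub> x)"

definition rmult1 :: "('a, 'm) sgrp_scheme \<Rightarrow> 'a \<Rightarrow> 'a option \<Rightarrow> 'a" where
  "rmult1 S x s = (case s of None \<Rightarrow> x | Some t \<Rightarrow> x \<cdot>\<^bsub>S\<^esub> t)"

definition green_L :: "('a, 'm) sgrp_scheme \<Rightarrow> ('a \<times> 'a) set" where
  "green_L S = {(a, b) \<in> carrier S \<times> carrier S.
     {lmult1 S s a | s. s \<in> carrier1 S} = {lmult1 S s b | s. s \<in> carrier1 S}}"

definition green_R :: "('a, 'm) sgrp_scheme \<Rightarrow> ('a \<times> 'a) set" where
  "green_R S = {(a, b) \<in> carrier S \<times> carrier S.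
     {rmult1 S a s | s. s \<in> carrier1 S} = {rmult1 S b s | s. s \<in> carrier1 S}}"

definition green_H :: "('a, 'm) sgrp_scheme \<Rightarrow> ('a \<times> 'a) set" where
  "green_H S = green_L S \<inter> green_R S"

definition H_classes :: "('a, 'm) sgrp_scheme \<Rightarrow> 'a set set" where
  "H_classes S = carrier S // green_H S"

definition max_subgroup :: "('a, 'm) sgrp_scheme \<Rightarrow> 'a \<Rightarrow> 'a monoid" where
  "max_subgroup S e =
    \<lparr>carrier = green_H S `` {e}, monoid.mult = sprod S, one = e\<rparr>"

definition stab :: "('a, 'm) sgrp_scheme \<Rightarrow> 'a set \<Rightarrow> 'a option set" where
  "stab S H = {s \<in> carrier1 S. (\<lambda>h. rmult1 S h s) ` H \<subseteq> H}"

definition right_translation ::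
    "('a, 'm) sgrp_scheme \<Rightarrow> 'a set \<Rightarrow> 'a option \<Rightarrow> 'a \<Rightarrow> 'a" where
  "right_translation S H s = (\<lambda>h \<in> H. rmult1 S h s)"

text \<open>Permutations act on the right, so the product of \<open>f\<close> and \<open>g\<close> is \<open>f\<close> followed by \<open>g\<close>, and
  the product of the translations by \<open>s\<close> and \<open>t\<close> is the translation by \<open>s t\<close>.\<close>

definition schutzenberger_group ::
    "('a, 'm) sgrp_scheme \<Rightarrow> 'a set \<Rightarrow> ('a \<Rightarrow> 'a) monoid" where
  "schutzenberger_group S H =
    \<lparr>carrier = right_translation S H ` stab S H,
     monoid.mult = (\<lambda>f g. compose H g f),
     one = (\<lambda>h \<in> H. h)\<rparr>"

definition divisor :: "('b, 'm) monoid_scheme \<Rightarrow> ('a, 'n) monoid_scheme \<Rightarrow> bool" where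
  "divisor D G \<longleftrightarrow>
    (\<exists>K N. subgroup K G \<and> N \<lhd> (G\<lparr>carrier := K\<rparr>) \<and> D \<cong> (G\<lparr>carrier := K\<rparr> Mod N))"

definition words :: "'a set \<Rightarrow> 'a list set" where
  "words A = {w. w \<noteq> [] \<and> set w \<subseteq> A}"

inductive_set gen_cong :: "'a set \<Rightarrow> ('a list \<times> 'a list) set \<Rightarrow> ('a list \<times> 'a list) set"
  for A R where
  base: "\<lbrakk>(u, v) \<in> R; u \<in> words A; v \<in> words A\<rbrakk> \<Longrightarrow> (u, v) \<in> gen_cong A R"
| refl: "u \<in> words A \<Longrightarrow> (u, u) \<in> gen_cong A R"
| sym: "(u, v) \<in> gen_cong A R \<Longrightarrow> (v, u) \<in> gen_cong A R"
| trans: "\<lbrakk>(u, v) \<in> gen_cong A R; (v, w) \<in> gen_cong A R\<rbrakk> \<Longrightarrow> (u, w) \<in> gen_cong A R"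
| left: "\<lbrakk>(u, v) \<in> gen_cong A R; w \<in> words A\<rbrakk> \<Longrightarrow> (w @ u, w @ v) \<in> gen_cong A R"
| right: "\<lbrakk>(u, v) \<in> gen_cong A R; w \<in> words A\<rbrakk> \<Longrightarrow> (u @ w, v @ w) \<in> gen_cong A R"

definition presented :: "'a set \<Rightarrow> ('a list \<times> 'a list) set \<Rightarrow> 'a list set sgrp" where
  "presented A R =
    \<lparr>carrier = words A // gen_cong A R,
     sprod = (\<lambda>X Y. \<Union>u \<in> X. \<Union>v \<in> Y. gen_cong A R `` {u @ v})\<rparr>"

text \<open>A partial operation is a function into an option type, \<open>None\<close> meaning undefined; its values
  at arguments outside the carrier are irrelevant.\<close>

record 'a partial_algebra = "'a partial_object" +
  pprod :: "'a \<Rightarrow> 'a \<Rightarrow> 'a option"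

definition is_partial_algebra :: "('a, 'm) partial_algebra_scheme \<Rightarrow> bool" where
  "is_partial_algebra E \<longleftrightarrow>
    (\<forall>e \<in> carrier E. \<forall>f \<in> carrier E. \<forall>g. pprod E e f = Some g \<longrightarrow> g \<in> carrier E)"

definition partial_algebra_iso ::
    "('a, 'm) partial_algebra_scheme \<Rightarrow> ('b, 'n) partial_algebra_scheme \<Rightarrow> ('a \<Rightarrow> 'b) set" where
  "partial_algebra_iso E F =
    {\<phi>. bij_betw \<phi> (carrier E) (carrier F) \<and>
        (\<forall>e \<in> carrier E. \<forall>f \<in> carrier E.
           pprod F (\<phi> e) (\<phi> f) = map_option \<phi> (pprod E e f))}"

definition biordered_of :: "('s, 'm) sgrp_scheme \<Rightarrow> 's partial_algebra" where
  "biordered_of S =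
    \<lparr>carrier = idempotents S,
     pprod = (\<lambda>e f. if {e \<cdot>\<^bsub>S\<^esub> f, f \<cdot>\<^bsub>S\<^esub> e} \<inter> {e, f} \<noteq> {} then Some (e \<cdot>\<^bsub>S\<^esub> f) else None)\<rparr>"

text \<open>Quantification over all semigroups is not possible inside a formula, so the type of the
  elements of the witnessing semigroup is a parameter. As a hypothesis of a theorem in which
  \<open>'s\<close> is a type variable, \<open>biordered_set TYPE('s) E\<close> allows witnesses of every type.\<close>

definition biordered_set :: "'s itself \<Rightarrow> ('a, 'm) partial_algebra_scheme \<Rightarrow> bool" where
  "biordered_set (_ :: 's itself) E \<longleftrightarrow>
    is_partial_algebra E \<and>
    (\<exists>S :: 's sgrp. sgrp S \<and> partial_algebra_iso E (biordered_of S) \<noteq> {})"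

definition basic_pair :: "('a, 'm) partial_algebra_scheme \<Rightarrow> 'a \<Rightarrow> 'a \<Rightarrow> bool" where
  "basic_pair E e f \<longleftrightarrow> e \<in> carrier E \<and> f \<in> carrier E \<and>
    {pprod E e f, pprod E f e} \<inter> {Some e, Some f} \<noteq> {}"

definition IG :: "('a, 'm) partial_algebra_scheme \<Rightarrow> 'a list set sgrp" where
  "IG E = presented (carrier E)
    {([e, f], [g]) | e f g. basic_pair E e f \<and> pprod E e f = Some g}"

end

theory Submission imports Defs begin

text \<open>Let \<open>a\<close> be an element of an \<open>\<H>\<close>-class \<open>H\<close> of \<open>IG(E)\<close>. It suffices to find an
  idempotent \<open>f\<close> with \<open>a f = a\<close> such that every \<open>u = f u f\<close> with \<open>a u = a\<close> is a unit of the
  local monoid of \<open>f\<close>: then each right translation of \<open>H\<close> is induced by an element of the maximal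
  subgroup at \<open>f\<close>, and the Schutzenberger group is a quotient of the subgroup
  \<open>{g. a g \<in> H}\<close>. Take for \<open>f\<close> a generator with \<open>a f = a\<close> whose \<open>\<L>\<close>-class is
  minimal; one exists because \<open>E\<close> is finite.

  Call a word a zone if it has a letter \<open>d\<close>, its seed, such that \<open>p d \<L> d \<R> d q\<close> for the words
  \<open>p\<close> and \<open>q\<close> before and after that letter. Rewriting with the relations \<open>e f = e \<cdot> f\<close> preserves
  the property of being a product of at most \<open>n\<close> zones. If \<open>w\<close> and \<open>v\<close> represent \<open>a\<close> and \<open>u\<close>,
  then all the words \<open>w v\<^sup>k\<close> represent \<open>a\<close>, hence are products of at most \<open>|w|\<close> zones, so
  for large \<open>k\<close> some zone contains \<open>v v\<close>. The position of its seed and the minimality of \<open>f\<close>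
  give \<open>f \<in> S u\<close>.

  The letters act partially on the finite set of \<open>\<R>\<close>-classes of idempotents of a semigroup that
  realises \<open>E\<close>, and this action respects the defining relations. Therefore every
  \<open>\<R>\<close>-class that meets the \<open>\<L>\<close>-class of a generator contains a generator, there are only
  finitely many such \<open>\<R>\<close>-classes, and left invertible elements are right invertible.\<close>

section \<open>Embedding semigroups into monoids\<close>

text \<open>Functions are wrapped so that they carry a \<open>monoid_mult\<close> instance, which
  gives \<open>prod_list\<close> and powers.\<close>

datatype 'b endo = Endo (app: "'b \<Rightarrow> 'b")

instantiation endo :: (type) monoid_mult
begin

definition one_endo :: "'a endo" where "one_endo = Endo id"

definition times_endo :: "'a endo \<Rightarrow> 'a endo \<Rightarrow> 'a endo" where
  "times_endo x y = Endo (app x \<circ> app y)"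

instance
  by standard (auto simp: one_endo_def times_endo_def o_assoc)

end

text \<open>The opposite monoid, which turns statements about \<open>\<R>\<close> into statements about \<open>\<L>\<close>.\<close>

datatype 'b opp = Opp (unopp: 'b)

instantiation opp :: (monoid_mult) monoid_mult
begin

definition one_opp :: "'a opp" where "one_opp = Opp 1"

definition times_opp :: "'a opp \<Rightarrow> 'a opp \<Rightarrow> 'a opp" where
  "times_opp x y = Opp (unopp y * unopp x)"

instance
  by standard (auto simp: one_opp_def times_opp_def mult.assoc)

end

lemma Opp_times [simp]: "Opp x * Opp y = Opp (y * x)"
  by (simp add: times_opp_def)

lemma prod_list_map_Opp: "prod_list (map (\<lambda>x. Opp (h x)) w) = Opp (prod_list (map h (rev w)))"
  by (induction w) (auto simp: one_opp_def)

text \<open>Left regular representation with a point adjoined: \<open>None\<close> serves as the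
  identity, so \<open>x\<close> can be read off from the image of \<open>None\<close>.\<close>

lemma (in sgrp) embedding:
  obtains \<theta> :: "'a \<Rightarrow> 'a option endo"
  where "inj_on \<theta> (carrier S)"
    and "\<And>x y. \<lbrakk>x \<in> carrier S; y \<in> carrier S\<rbrakk> \<Longrightarrow> \<theta> (x \<cdot> y) = \<theta> x * \<theta> y"
proof -
  define \<theta> where "\<theta> x = Endo (\<lambda>s. case s of None \<Rightarrow> Some x
    | Some y \<Rightarrow> if y \<in> carrier S then Some (x \<cdot> y) else Some y)" for x
  have "inj_on \<theta> (carrier S)"
    by (rule inj_onI) (auto simp: \<theta>_def dest: fun_cong[of _ _ None])
  moreover have "\<theta> (x \<cdot> y) = \<theta> x * \<theta> y" if "x \<in> carrier S" "y \<in> carrier S" for x y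
    using that by (auto simp: \<theta>_def times_endo_def fun_eq_iff closed assoc split: option.split)
  ultimately show thesis using that by blast
qed

section \<open>Powers of words\<close>

lemma concat_eq_append_Cons:
  "concat ws = x @ g # y \<Longrightarrow>
    \<exists>ws1 z1 z2 ws2. ws = ws1 @ (z1 @ g # z2) # ws2 \<and> x = concat ws1 @ z1 \<and> y = z2 @ concat ws2"
proof (induction ws arbitrary: x)
  case (Cons z ws)
  then have "z @ concat ws = x @ g # y" by simp
  then consider us where "z @ us = x" "concat ws = us @ g # y"
    | us where "z = x @ g # us" "us @ concat ws = y"
    by (auto simp: append_eq_append_conv2 append_eq_Cons_conv)
  then show ?case
  proof cases
    case 1
    then obtain ws1 z1 z2 ws2
      where "ws = ws1 @ (z1 @ g # z2) # ws2" "us = concat ws1 @ z1" "y = z2 @ concat ws2"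
      using Cons.IH by blast
    then show ?thesis using 1 by (intro exI[of _ "z # ws1"]) auto
  next
    case 2
    then show ?thesis by (intro exI[of _ "[]"] exI[of _ x] exI[of _ us] exI[of _ ws]) auto
  qed
qed simp

abbreviation pow_word :: "nat \<Rightarrow> 'a list \<Rightarrow> 'a list" where
  "pow_word n v \<equiv> concat (replicate n v)"

lemma pow_word_eq_append_Cons:
  assumes "pow_word n v = p @ d # q"
  shows "\<exists>i v1 v2. v = v1 @ d # v2 \<and> p = pow_word i v @ v1"
proof -
  obtain ws1 z1 z2 ws2 where ws: "replicate n v = ws1 @ (z1 @ d # z2) # ws2" "p = concat ws1 @ z1"
    using concat_eq_append_Cons[OF assms] by blast
  then have "\<forall>z \<in> set (ws1 @ (z1 @ d # z2) # ws2). z = v" by (metis in_set_replicate)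
  then have "v = z1 @ d # z2" "ws1 = replicate (length ws1) v"
    by (auto simp: replicate_length_same)
  then show ?thesis using ws(2) by metis
qed

text \<open>Pigeonhole: there are more blocks \<open>v @ v\<close> than factors. In the induction, a
  first factor that does not contain the first block spoils no other block, and the uncovered rest
  \<open>us\<close> takes over the role of \<open>w\<close>.\<close>

lemma concat_contains_square:
  assumes "v \<noteq> []" and "length ws < k" and "concat ws = w @ pow_word k (v @ v)"
  shows "\<exists>ws1 z1 z2 ws2 i j. ws = ws1 @ (z1 @ v @ v @ z2) # ws2 \<and>
    concat ws1 @ z1 = w @ pow_word i v \<and> z2 @ concat ws2 = pow_word j v"
  using assms(2,3)
proof (induction ws arbitrary: w k)
  case Nil
  then show ?case using assms(1) by (cases k) auto
next
  case (Cons z ws)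
  then obtain k' where k: "k = Suc k'" by (cases k) auto
  have square: "pow_word n (v @ v) = pow_word (2 * n) v" for n by (induction n) auto
  have "z @ concat ws = (w @ v @ v) @ pow_word k' (v @ v)" using Cons.prems k by simp
  from append_eq_append_conv2[THEN iffD1, OF this]
  consider us where "z = (w @ v @ v) @ us" "us @ concat ws = pow_word k' (v @ v)"
    | us where "z @ us = w @ v @ v" "concat ws = us @ pow_word k' (v @ v)"
    by blast
  then show ?case
  proof cases
    case 1
    then show ?thesis
      by (intro exI[of _ "[]"] exI[of _ w] exI[of _ us] exI[of _ ws] exI[of _ 0] exI[of _ "2 * k'"])
        (auto simp: square)
  next
    case 2
    have "length ws < k'" using Cons.prems k by simp
    from Cons.IH[OF this 2(2)] obtain ws1 z1 z2 ws2 i j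
      where ws: "ws = ws1 @ (z1 @ v @ v @ z2) # ws2" "concat ws1 @ z1 = us @ pow_word i v"
        "z2 @ concat ws2 = pow_word j v" by blast
    have "concat (z # ws1) @ z1 = (z @ us) @ pow_word i v" using ws(2) by simp
    also have "\<dots> = w @ pow_word (Suc (Suc i)) v" unfolding 2(1) by simp
    finally have "concat (z # ws1) @ z1 = w @ pow_word (Suc (Suc i)) v" .
    then show ?thesis using ws by (metis append_Cons)
  qed
qed

section \<open>The action of the generators on Green classes\<close>

text \<open>Basic pairs and their products seen through \<open>\<psi>\<close>; as a relation it
  dualises by swapping \<open>e\<close> and \<open>f\<close>.\<close>

definition basic_prod :: "'a set \<Rightarrow> ('a \<Rightarrow> 's::monoid_mult) \<Rightarrow> 'a \<Rightarrow> 'a \<Rightarrow> 'a \<Rightarrow> bool" where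
  "basic_prod E \<psi> e f g \<longleftrightarrow> e \<in> E \<and> f \<in> E \<and> g \<in> E \<and> \<psi> g = \<psi> e * \<psi> f \<and>
     {\<psi> e * \<psi> f, \<psi> f * \<psi> e} \<inter> {\<psi> e, \<psi> f} \<noteq> {}"

text \<open>The map \<open>\<psi>\<close> realises \<open>E\<close> as the set of idempotents of a semigroup \<open>C\<close>, and \<open>\<gamma>\<close> sends the
  generators into a monoid that contains \<open>IG(E)\<close>. The assumption \<open>rewrite_invariant\<close> says that the
  relations among the generators all follow from the basic products; in this form it is inherited
  by the opposite monoid.\<close>

locale idem_presentation =
  fixes E :: "'a set" and \<psi> :: "'a \<Rightarrow> 's::monoid_mult" and C :: "'s set"
    and \<gamma> :: "'a \<Rightarrow> 'm::monoid_mult"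
  assumes C_mult: "\<lbrakk>x \<in> C; y \<in> C\<rbrakk> \<Longrightarrow> x * y \<in> C"
    and \<psi>_bij: "bij_betw \<psi> E {h \<in> C. h * h = h}"
    and finite_E: "finite E"
    and \<gamma>_mult: "basic_prod E \<psi> e f g \<Longrightarrow> \<gamma> e * \<gamma> f = \<gamma> g"
    and rewrite_invariant:
      "\<lbrakk>\<And>x y e f g. \<lbrakk>basic_prod E \<psi> e f g; set x \<subseteq> E; set y \<subseteq> E\<rbrakk>
          \<Longrightarrow> Q (x @ [e, f] @ y) \<longleftrightarrow> Q (x @ [g] @ y);
        u \<in> words E; v \<in> words E; prod_list (map \<gamma> u) = prod_list (map \<gamma> v)\<rbrakk>
       \<Longrightarrow> Q u \<longleftrightarrow> Q v"
begin

section \<open>Green's relations relative to the submonoid of generators\<close>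

abbreviation "\<mu> w \<equiv> prod_list (map \<gamma> w)"

definition M :: "'m set" where "M = \<mu> ` {w. set w \<subseteq> E}"

definition RR :: "'m \<Rightarrow> 'm \<Rightarrow> bool" where
  "RR x y \<longleftrightarrow> (\<exists>s \<in> M. x * s = y) \<and> (\<exists>s \<in> M. y * s = x)"

definition LL :: "'m \<Rightarrow> 'm \<Rightarrow> bool" where
  "LL x y \<longleftrightarrow> (\<exists>s \<in> M. s * x = y) \<and> (\<exists>s \<in> M. s * y = x)"

lemma \<mu>_in_M [simp]: "set w \<subseteq> E \<Longrightarrow> \<mu> w \<in> M"
  by (auto simp: M_def)

lemma \<gamma>_in_M [simp]: "e \<in> E \<Longrightarrow> \<gamma> e \<in> M"
  using \<mu>_in_M[of "[e]"] by simp

lemma one_in_M [simp]: "1 \<in> M"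
  using \<mu>_in_M[of "[]"] by simp

lemma mult_in_M [simp]: "\<lbrakk>x \<in> M; y \<in> M\<rbrakk> \<Longrightarrow> x * y \<in> M"
  unfolding M_def
proof clarify
  fix u v assume "set u \<subseteq> E" "set v \<subseteq> E"
  then show "\<mu> u * \<mu> v \<in> \<mu> ` {w. set w \<subseteq> E}"
    by (intro image_eqI[of _ _ "u @ v"]) auto
qed

lemma power_in_M [simp]: "x \<in> M \<Longrightarrow> x ^ n \<in> M"
  by (induction n) auto

lemma RR_refl [simp]: "RR x x" and LL_refl [simp]: "LL x x"
  by (auto simp: RR_def LL_def intro!: bexI[of _ 1])

lemma RR_sym: "RR x y \<Longrightarrow> RR y x"
  by (auto simp: RR_def)

lemma RR_trans [trans]:
  assumes "RR x y" "RR y z"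
  shows "RR x z"
proof -
  obtain s t s' t' where st: "s \<in> M" "t \<in> M" "s' \<in> M" "t' \<in> M"
    and eq: "x * s = y" "y * t = x" "y * s' = z" "z * t' = y"
    using assms unfolding RR_def by blast
  have "x * (s * s') = z" "z * (t' * t) = x"
    by (simp_all add: eq mult.assoc[symmetric])
  then show ?thesis unfolding RR_def using st mult_in_M by blast
qed

lemma RR_mult: "RR x y \<Longrightarrow> RR (z * x) (z * y)"
  unfolding RR_def by (metis mult.assoc)

lemma LL_mult: "LL x y \<Longrightarrow> LL (x * z) (y * z)"
  unfolding LL_def by (metis mult.assoc)

text \<open>\<open>x * y\<close> lies between \<open>x\<close> and \<open>x * y * z\<close> in the
  order of principal right ideals.\<close>

lemma RR_between:
  assumes "RR (x * y * z) x" "y \<in> M" "z \<in> M"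
  shows "RR (x * y) x"
proof -
  obtain s where s: "s \<in> M" "x * y * z * s = x" using assms unfolding RR_def by blast
  then have "x * y * (z * s) = x" by (simp add: mult.assoc)
  then show ?thesis unfolding RR_def using assms s mult_in_M by metis
qed

lemma LL_between:
  assumes "LL (x * (y * z)) z" "x \<in> M" "y \<in> M"
  shows "LL (y * z) z"
proof -
  obtain s where s: "s \<in> M" "s * (x * (y * z)) = z" using assms unfolding LL_def by blast
  then have "s * x * (y * z) = z" by (simp add: mult.assoc)
  then show ?thesis unfolding LL_def using assms s mult_in_M by metis
qed

lemma \<psi>_idem: "e \<in> E \<Longrightarrow> \<psi> e * \<psi> e = \<psi> e" and \<psi>_in_C: "e \<in> E \<Longrightarrow> \<psi> e \<in> C"
  using \<psi>_bij by (auto simp: bij_betw_def)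

lemma \<psi>_inj: "\<lbrakk>\<psi> e = \<psi> f; e \<in> E; f \<in> E\<rbrakk> \<Longrightarrow> e = f"
  using \<psi>_bij by (auto simp: bij_betw_def inj_on_def)

lemma \<psi>_surj: "\<lbrakk>h \<in> C; h * h = h\<rbrakk> \<Longrightarrow> \<exists>e \<in> E. \<psi> e = h"
  using \<psi>_bij unfolding bij_betw_def by (auto simp: image_iff set_eq_iff) metis

lemma \<gamma>_idem: "e \<in> E \<Longrightarrow> \<gamma> e * \<gamma> e = \<gamma> e"
  by (rule \<gamma>_mult) (auto simp: basic_prod_def \<psi>_idem)

text \<open>In Green's terms, \<open>\<gamma> g\<close> is \<R>-related to its left factor or
  \<L>-related to its right factor. This decides where a seed moves when a product is split.\<close>

lemma basic_prod_cases:
  assumes "basic_prod E \<psi> e f g"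
  shows "\<gamma> g * \<gamma> e = \<gamma> e \<or> \<gamma> f * \<gamma> g = \<gamma> f"
proof -
  have EE: "e \<in> E" "f \<in> E" "g \<in> E" and g: "\<psi> g = \<psi> e * \<psi> f"
    using assms by (auto simp: basic_prod_def)
  consider "\<psi> e * \<psi> f = \<psi> e" | "\<psi> e * \<psi> f = \<psi> f" | "\<psi> f * \<psi> e = \<psi> e" | "\<psi> f * \<psi> e = \<psi> f"
    using assms by (auto simp: basic_prod_def)
  then show ?thesis
  proof cases
    case 1
    then have "g = e" using EE g by (auto intro: \<psi>_inj)
    then show ?thesis using EE \<gamma>_idem by simp
  next
    case 2
    then have "g = f" using EE g by (auto intro: \<psi>_inj)
    then show ?thesis using EE \<gamma>_idem by simp
  next
    case 3
    then have "\<psi> g * \<psi> e = \<psi> e" by (simp add: g mult.assoc \<psi>_idem EE)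
    then show ?thesis using EE by (auto intro!: \<gamma>_mult simp: basic_prod_def)
  next
    case 4
    then have "\<psi> f * \<psi> g = \<psi> f" by (simp add: g mult.assoc[symmetric] \<psi>_idem EE)
    then show ?thesis using EE by (auto intro!: \<gamma>_mult simp: basic_prod_def)
  qed
qed

lemma RR_if_\<psi>:
  assumes "e \<in> E" "f \<in> E" "\<psi> e * \<psi> f = \<psi> f" "\<psi> f * \<psi> e = \<psi> e"
  shows "RR (\<gamma> e) (\<gamma> f)"
proof -
  have "\<gamma> e * \<gamma> f = \<gamma> f" "\<gamma> f * \<gamma> e = \<gamma> e"
    using assms by (auto intro!: \<gamma>_mult simp: basic_prod_def)
  then show ?thesis using assms by (auto simp: RR_def)
qed

text \<open>\<open>act d r r'\<close> means that \<open>d\<close> maps the \<open>\<R>\<close>-class of \<open>r\<close> in the realising semigroup to that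
  of \<open>r'\<close>: the class of \<open>r\<close> contains an idempotent \<open>h\<close> with \<open>h d = h\<close>, and then \<open>d h\<close> is
  idempotent and \<open>r' \<R> d h\<close>.\<close>

definition act :: "'a \<Rightarrow> 'a \<Rightarrow> 'a \<Rightarrow> bool" where
  "act d r r' \<longleftrightarrow> d \<in> E \<and> r \<in> E \<and> r' \<in> E \<and>
    (\<exists>h \<in> E. \<psi> h * \<psi> r = \<psi> r \<and> \<psi> r * \<psi> h = \<psi> h \<and> \<psi> h * \<psi> d = \<psi> h \<and>
       \<psi> r' * (\<psi> d * \<psi> h) = \<psi> d * \<psi> h \<and> \<psi> d * \<psi> h * \<psi> r' = \<psi> r')"

primrec acts :: "'a list \<Rightarrow> 'a \<Rightarrow> 'a \<Rightarrow> bool" where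
  "acts [] r r' \<longleftrightarrow> r = r'"
| "acts (d # w) r r' \<longleftrightarrow> (\<exists>r1. acts w r r1 \<and> act d r1 r')"

lemma acts_append: "acts (u @ v) r r' \<longleftrightarrow> (\<exists>r1. acts v r r1 \<and> acts u r1 r')"
  by (induction u arbitrary: r') auto

lemma act_basic_prod:
  assumes "basic_prod E \<psi> e f g"
  shows "(\<exists>r1. act f r r1 \<and> act e r1 r') \<longleftrightarrow> act g r r'"
proof -
  have EE: "e \<in> E" "f \<in> E" "g \<in> E" and g: "\<psi> g = \<psi> e * \<psi> f"
    using assms by (auto simp: basic_prod_def)
  show ?thesis
  proof
    assume "\<exists>r1. act f r r1 \<and> act e r1 r'"
    then obtain r1 h1 h2 where rE: "r \<in> E" "r1 \<in> E" "r' \<in> E" "h1 \<in> E" "h2 \<in> E"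
      and a: "\<psi> h1 * \<psi> r = \<psi> r" "\<psi> r * \<psi> h1 = \<psi> h1" "\<psi> h1 * \<psi> f = \<psi> h1"
        "\<psi> r1 * (\<psi> f * \<psi> h1) = \<psi> f * \<psi> h1" "\<psi> f * \<psi> h1 * \<psi> r1 = \<psi> r1"
      and b: "\<psi> h2 * \<psi> r1 = \<psi> r1" "\<psi> r1 * \<psi> h2 = \<psi> h2" "\<psi> h2 * \<psi> e = \<psi> h2"
        "\<psi> r' * (\<psi> e * \<psi> h2) = \<psi> e * \<psi> h2" "\<psi> e * \<psi> h2 * \<psi> r' = \<psi> r'"
      unfolding act_def by blast
    \<comment> \<open>The witness for \<open>g\<close>: ending in \<open>\<psi> g\<close> makes
      \<open>\<psi> g\<close> fix it on the right, and by \<open>hh1\<close> it stays in the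
      \<R>-class of \<open>\<psi> h1\<close>.\<close>
    define h where "h = \<psi> h1 * \<psi> h2 * \<psi> g"
    \<comment> \<open>\<open>\<psi> f * \<psi> h1\<close> and \<open>\<psi> h2\<close> are
      idempotents in the \<R>-class of \<open>\<psi> r1\<close>, so each is a left identity for the
      other.\<close>
    have fh: "\<psi> f * \<psi> h1 * \<psi> h2 = \<psi> h2" "\<psi> h2 * (\<psi> f * \<psi> h1) = \<psi> f * \<psi> h1"
      using a b by (metis mult.assoc)+
    have hh1: "h * \<psi> h1 = \<psi> h1"
    proof -
      have "h * \<psi> h1 = \<psi> h1 * (\<psi> h2 * \<psi> e) * (\<psi> f * \<psi> h1)"
        by (simp add: h_def g mult.assoc)
      also have "\<dots> = \<psi> h1 * \<psi> f * \<psi> h1"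
        using b(3) fh(2) by (simp add: mult.assoc)
      also have "\<dots> = \<psi> h1" using a(3) \<psi>_idem rE by simp
      finally show ?thesis .
    qed
    have hh: "h * h = h" using hh1 by (metis h_def mult.assoc)
    have hr: "h * \<psi> r = \<psi> r" "\<psi> r * h = h"
      using a hh1 by (metis h_def mult.assoc)+
    have hg: "h * \<psi> g = h" by (simp add: h_def mult.assoc \<psi>_idem EE)
    have gh: "\<psi> g * h = \<psi> e * \<psi> h2 * \<psi> g"
      unfolding h_def g using fh(1) by (metis mult.assoc)
    have ghi: "\<psi> g * h * (\<psi> g * h) = \<psi> g * h" using hg hh by (metis mult.assoc)
    have "\<psi> g * h * (\<psi> r * \<psi> h1 * \<psi> h2) = \<psi> e * (\<psi> f * \<psi> h1 * \<psi> h2)"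
      using hh1 a(2) by (metis g mult.assoc)
    then have "\<psi> g * h * (\<psi> r * \<psi> h1 * \<psi> h2) = \<psi> e * \<psi> h2" by (simp add: fh)
    then have geh: "\<psi> g * h * (\<psi> e * \<psi> h2) = \<psi> e * \<psi> h2"
      using ghi by (metis mult.assoc)
    \<comment> \<open>\<open>h\<close> need not be a basic product; it comes from \<open>E\<close>
      because \<open>\<psi>\<close> reaches every idempotent of \<open>C\<close>.\<close>
    have "h \<in> C" using rE EE by (simp add: h_def C_mult \<psi>_in_C)
    then obtain k where k: "k \<in> E" "\<psi> k = h" using \<psi>_surj hh by blast
    have "\<psi> r' * (\<psi> g * h) = \<psi> g * h" using b(4) gh by (metis mult.assoc)
    moreover have "\<psi> g * h * \<psi> r' = \<psi> r'" using geh b(5) by (metis mult.assoc)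
    ultimately show "act g r r'" unfolding act_def using k hr hg rE EE by auto
  next
    assume "act g r r'"
    then obtain k where rE: "r \<in> E" "r' \<in> E" "k \<in> E"
      and a: "\<psi> k * \<psi> r = \<psi> r" "\<psi> r * \<psi> k = \<psi> k" "\<psi> k * \<psi> g = \<psi> k"
        "\<psi> r' * (\<psi> g * \<psi> k) = \<psi> g * \<psi> k" "\<psi> g * \<psi> k * \<psi> r' = \<psi> r'"
      unfolding act_def by blast
    have kf: "\<psi> k * \<psi> f = \<psi> k" using a(3) g \<psi>_idem EE by (metis mult.assoc)
    have kk: "\<psi> k * \<psi> k = \<psi> k" using rE \<psi>_idem by simp
    have fki: "\<psi> f * \<psi> k * (\<psi> f * \<psi> k) = \<psi> f * \<psi> k" using kf kk by (metis mult.assoc)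
    have "\<psi> f * \<psi> k \<in> C" using EE rE by (simp add: C_mult \<psi>_in_C)
    then obtain r1 where r1: "r1 \<in> E" "\<psi> r1 = \<psi> f * \<psi> k" using \<psi>_surj fki by blast
    \<comment> \<open>The witness for \<open>e\<close>: \<open>\<psi> e\<close> fixes it on the
      right, and \<open>kef\<close> puts it in the \<R>-class of \<open>\<psi> r1\<close>.\<close>
    define h where "h = \<psi> f * \<psi> k * \<psi> e"
    have kef: "\<psi> k * (\<psi> e * (\<psi> f * \<psi> k)) = \<psi> k" using a(3) kk by (metis g mult.assoc)
    have hr1: "h * \<psi> r1 = \<psi> r1" using kef by (simp add: h_def r1 mult.assoc)
    have hh: "h * h = h" using hr1 by (metis h_def mult.assoc r1(2))
    have r1h: "\<psi> r1 * h = h" using fki by (metis h_def mult.assoc r1(2))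
    have he: "h * \<psi> e = h" using EE by (simp add: h_def mult.assoc \<psi>_idem)
    have "h \<in> C" using EE rE by (simp add: h_def C_mult \<psi>_in_C)
    then obtain l where l: "l \<in> E" "\<psi> l = h" using \<psi>_surj hh by blast
    have eh: "\<psi> e * h = \<psi> g * \<psi> k * \<psi> e" by (simp add: h_def g mult.assoc)
    have "\<psi> g * \<psi> k * \<psi> e * (\<psi> g * \<psi> k) = \<psi> g * \<psi> k"
    proof -
      have "\<psi> g * \<psi> k * \<psi> e * (\<psi> g * \<psi> k) = \<psi> g * \<psi> k * (\<psi> e * \<psi> e) * (\<psi> f * \<psi> k)"
        by (simp add: g mult.assoc)
      also have "\<dots> = \<psi> g * (\<psi> k * (\<psi> e * (\<psi> f * \<psi> k)))"
        using EE by (simp add: \<psi>_idem mult.assoc)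
      finally show ?thesis using kef by simp
    qed
    then have "\<psi> e * h * \<psi> r' = \<psi> r'" using a(5) eh by (metis mult.assoc)
    moreover have "\<psi> r' * (\<psi> e * h) = \<psi> e * h" using a(4) eh by (metis mult.assoc)
    ultimately have "act e r1 r'" unfolding act_def using l hr1 r1h he rE EE r1 by auto
    moreover have "act f r r1" unfolding act_def using a kf rE EE r1 fki by auto
    ultimately show "\<exists>r1. act f r r1 \<and> act e r1 r'" by blast
  qed
qed

lemma acts_invariant:
  assumes "u \<in> words E" "v \<in> words E" "\<mu> u = \<mu> v"
  shows "acts u r r' \<longleftrightarrow> acts v r r'"
proof (rule rewrite_invariant[OF _ assms])
  fix x y e f g assume "basic_prod E \<psi> e f g"
  from act_basic_prod[OF this] have "acts [e, f] r r' \<longleftrightarrow> acts [g] r r'" for r r'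
    by simp
  then show "acts (x @ [e, f] @ y) r r' \<longleftrightarrow> acts (x @ [g] @ y) r r'"
    unfolding acts_append by (simp only:)
qed

text \<open>The condition \<open>\<psi> h * \<psi> d = \<psi> h\<close> in \<open>act\<close> makes
  \<open>d\<close> and \<open>h\<close> a basic pair, so \<open>\<gamma> d * \<gamma> h\<close> is
  again a generator and left multiplication in \<open>M\<close> follows the action.\<close>

lemma acts_RR: "\<lbrakk>acts w r r'; set w \<subseteq> E; r \<in> E\<rbrakk> \<Longrightarrow> r' \<in> E \<and> RR (\<mu> w * \<gamma> r) (\<gamma> r')"
proof (induction w arbitrary: r')
  case (Cons d w)
  then obtain r1 where r1: "RR (\<mu> w * \<gamma> r) (\<gamma> r1)" "act d r1 r'" by auto
  then obtain h where E: "d \<in> E" "r1 \<in> E" "r' \<in> E" "h \<in> E"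
    and a: "\<psi> h * \<psi> r1 = \<psi> r1" "\<psi> r1 * \<psi> h = \<psi> h" "\<psi> h * \<psi> d = \<psi> h"
      "\<psi> r' * (\<psi> d * \<psi> h) = \<psi> d * \<psi> h" "\<psi> d * \<psi> h * \<psi> r' = \<psi> r'"
    unfolding act_def by blast
  have "\<psi> d * \<psi> h * (\<psi> d * \<psi> h) = \<psi> d * \<psi> h" using a(3) \<psi>_idem E by (metis mult.assoc)
  then obtain k where k: "k \<in> E" "\<psi> k = \<psi> d * \<psi> h"
    using \<psi>_surj C_mult \<psi>_in_C E by meson
  have dh: "\<gamma> d * \<gamma> h = \<gamma> k" using k E a by (auto intro!: \<gamma>_mult simp: basic_prod_def)
  have "RR (\<gamma> d * (\<mu> w * \<gamma> r)) (\<gamma> d * \<gamma> r1)" by (rule RR_mult[OF r1(1)])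
  moreover have "RR (\<gamma> d * \<gamma> r1) (\<gamma> d * \<gamma> h)"
    by (rule RR_mult, rule RR_if_\<psi>) (use E a in auto)
  moreover have "RR (\<gamma> k) (\<gamma> r')" by (rule RR_if_\<psi>) (use E k a in auto)
  ultimately show ?case using dh E by (auto intro: RR_trans simp: mult.assoc)
qed auto

text \<open>Write \<open>\<gamma> e\<close> as \<open>\<mu> t * (x * \<gamma> e)\<close>. The word
  \<open>[e]\<close> takes \<open>e\<close> to \<open>e\<close>, hence so does the longer word, and
  its suffix for \<open>x * \<gamma> e\<close> takes \<open>e\<close> to some \<open>r\<close> on
  the way.\<close>

lemma RR_generator:
  assumes "x \<in> M" "LL (x * \<gamma> e) (\<gamma> e)" "e \<in> E"
  shows "\<exists>r \<in> E. RR (x * \<gamma> e) (\<gamma> r)"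
proof -
  obtain p t where p: "set p \<subseteq> E" "x = \<mu> p" and t: "set t \<subseteq> E" "\<mu> t * (x * \<gamma> e) = \<gamma> e"
    using assms unfolding LL_def M_def by blast
  have "act e e e" unfolding act_def using assms(3) by (auto intro!: bexI[of _ e] simp: \<psi>_idem)
  then have "acts [e] e e" by simp
  moreover have "acts [e] e e \<longleftrightarrow> acts (t @ p @ [e]) e e"
    by (rule acts_invariant) (use p t assms(3) in \<open>auto simp: words_def mult.assoc\<close>)
  ultimately obtain r where r: "acts (p @ [e]) e r" by (auto simp: acts_append)
  have "RR (\<mu> (p @ [e]) * \<gamma> e) (\<gamma> r)" "r \<in> E"
    using acts_RR[OF r] p assms(3) by auto
  then show ?thesis using p assms(3) by (auto simp: mult.assoc \<gamma>_idem)
qed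

section \<open>Zones\<close>

definition zone_at :: "'a list \<Rightarrow> 'a \<Rightarrow> 'a list \<Rightarrow> bool" where
  "zone_at p d q \<longleftrightarrow> set p \<subseteq> E \<and> d \<in> E \<and> set q \<subseteq> E \<and>
     LL (\<mu> p * \<gamma> d) (\<gamma> d) \<and> RR (\<gamma> d * \<mu> q) (\<gamma> d)"

definition zone :: "'a list \<Rightarrow> bool" where
  "zone w \<longleftrightarrow> (\<exists>p d q. w = p @ d # q \<and> zone_at p d q)"

lemma basic_prodD:
  assumes "basic_prod E \<psi> e f g"
  shows "e \<in> E" "f \<in> E" "g \<in> E"
  using assms by (auto simp: basic_prod_def)

text \<open>Here \<open>\<gamma> g\<close> is \<R>-related to \<open>\<gamma> e\<close>, so the seed
  moves to \<open>e\<close>; right multiplication by \<open>\<gamma> e\<close> carries the condition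
  on \<open>p\<close> along.\<close>

lemma zone_at_split_left:
  assumes b: "basic_prod E \<psi> e f g" and "\<gamma> g * \<gamma> e = \<gamma> e" and z: "zone_at p g q"
  shows "zone_at p e (f # q)"
proof -
  note E = basic_prodD[OF b]
  have ge: "RR (\<gamma> g) (\<gamma> e)"
    unfolding RR_def using E assms(2) \<gamma>_mult[OF b] by (meson \<gamma>_in_M)
  have "LL (\<mu> p * \<gamma> g * \<gamma> e) (\<gamma> g * \<gamma> e)"
    using z by (intro LL_mult) (simp add: zone_at_def)
  then have "LL (\<mu> p * \<gamma> e) (\<gamma> e)" by (simp add: mult.assoc assms(2))
  moreover have "RR (\<gamma> g * \<mu> q) (\<gamma> e)"
    using z ge by (auto simp: zone_at_def intro: RR_trans)
  ultimately show ?thesis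
    using z E \<gamma>_mult[OF b] by (simp add: zone_at_def mult.assoc[symmetric])
qed

text \<open>By \<open>RR_between\<close>, \<open>\<gamma> e * \<gamma> f\<close> stays in the
  \<R>-class of \<open>\<gamma> e\<close>; right multiplication by \<open>\<gamma> f\<close>
  transfers the condition on \<open>p\<close>.\<close>

lemma zone_at_join_left:
  assumes b: "basic_prod E \<psi> e f g" and z: "zone_at p e (f # q)"
  shows "zone_at p g q"
proof -
  note E = basic_prodD[OF b] and ef = \<gamma>_mult[OF b]
  have q: "\<mu> q \<in> M" using z by (auto simp: zone_at_def)
  have 1: "RR (\<gamma> e * \<gamma> f * \<mu> q) (\<gamma> e)" using z by (simp add: zone_at_def mult.assoc)
  then have "RR (\<gamma> e * \<gamma> f) (\<gamma> e)" by (rule RR_between) (use E q in auto)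
  with 1 have "RR (\<gamma> g * \<mu> q) (\<gamma> g)" using ef by (metis RR_trans RR_sym)
  moreover have "LL (\<mu> p * \<gamma> e * \<gamma> f) (\<gamma> e * \<gamma> f)"
    using z by (intro LL_mult) (simp add: zone_at_def)
  ultimately show ?thesis using z E by (simp add: zone_at_def mult.assoc ef)
qed

text \<open>From its seed on, the old zone has a value \<open>y * \<gamma> e\<close>, and left
  multiplication by \<open>y\<close> preserves \<R>; so the seed survives.\<close>

lemma zone_append:
  assumes "zone (a @ [e])" and "RR (\<gamma> e * \<mu> b) (\<gamma> e)" and "set b \<subseteq> E"
  shows "zone (a @ e # b)"
proof -
  obtain p d q where w: "a @ [e] = p @ d # q" and z: "zone_at p d q"
    using assms(1) by (auto simp: zone_def)
  obtain y where y: "\<gamma> d * \<mu> q = y * \<gamma> e"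
  proof (cases q rule: rev_cases)
    case Nil
    then show ?thesis using that[of 1] w by simp
  next
    case (snoc q' e')
    then have "e' = e" using w by auto
    then show ?thesis using that[of "\<gamma> d * \<mu> q'"] snoc by (simp add: mult.assoc)
  qed
  have "RR (y * (\<gamma> e * \<mu> b)) (y * \<gamma> e)" by (rule RR_mult[OF assms(2)])
  then have "RR (\<gamma> d * \<mu> q * \<mu> b) (\<gamma> d * \<mu> q)" by (simp add: y mult.assoc)
  then have "RR (\<gamma> d * \<mu> (q @ b)) (\<gamma> d)"
    using z by (auto simp: zone_at_def mult.assoc intro: RR_trans)
  then have "zone_at p d (q @ b)" using z assms(3) by (simp add: zone_at_def)
  moreover have "a @ e # b = p @ d # (q @ b)" using w by (metis append.assoc append_Cons append_Nil)
  ultimately show ?thesis unfolding zone_def by blast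
qed

text \<open>If \<open>f\<close> is not the seed, the seed lies in \<open>b\<close>, and
  \<open>LL_between\<close> keeps its left condition.\<close>

lemma zone_Cons:
  assumes "zone (f # b)"
  shows "zone b \<or> RR (\<gamma> f * \<mu> b) (\<gamma> f) \<and> set b \<subseteq> E \<and> f \<in> E"
proof -
  obtain p d q where w: "f # b = p @ d # q" and z: "zone_at p d q"
    using assms by (auto simp: zone_def)
  show ?thesis
  proof (cases p)
    case Nil
    then show ?thesis using w z by (auto simp: zone_at_def)
  next
    case (Cons f' p')
    then have "LL (\<gamma> f * (\<mu> p' * \<gamma> d)) (\<gamma> d)" and "\<gamma> f \<in> M" "\<mu> p' \<in> M"
      using w z by (auto simp: zone_at_def mult.assoc)
    then have "LL (\<mu> p' * \<gamma> d) (\<gamma> d)" by (rule LL_between)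
    then have "zone_at p' d q" "b = p' @ d # q" using z w Cons by (auto simp: zone_at_def)
    then show ?thesis unfolding zone_def by blast
  qed
qed

section \<open>Duality\<close>

lemma basic_prod_Opp: "basic_prod E (\<lambda>e. Opp (\<psi> e)) e f g \<longleftrightarrow> basic_prod E \<psi> f e g"
  by (auto simp: basic_prod_def)

lemma opposite: "idem_presentation E (\<lambda>e. Opp (\<psi> e)) (Opp ` C) (\<lambda>e. Opp (\<gamma> e))"
proof (unfold_locales, goal_cases)
  case (1 x y)
  then show ?case using C_mult by auto
next
  case 2
  have "{h \<in> Opp ` C. h * h = h} = Opp ` {h \<in> C. h * h = h}" by auto
  moreover have "bij_betw Opp {h \<in> C. h * h = h} (Opp ` {h \<in> C. h * h = h})"
    by (auto simp: bij_betw_def inj_on_def)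
  ultimately show ?case
    using bij_betw_trans[OF \<psi>_bij] by (simp add: comp_def)
next
  case 3
  show ?case by (rule finite_E)
next
  case (4 e f g)
  then show ?case using \<gamma>_mult by (simp add: basic_prod_Opp)
next
  case (5 Q u v)
  have "Q (rev (rev u)) \<longleftrightarrow> Q (rev (rev v))"
  proof (rule rewrite_invariant[where Q = "\<lambda>w. Q (rev w)"])
    show "rev u \<in> words E" "rev v \<in> words E" using 5 by (auto simp: words_def)
    show "\<mu> (rev u) = \<mu> (rev v)" using 5(4) by (simp add: prod_list_map_Opp)
    fix x y e f g assume "basic_prod E \<psi> e f g" "set x \<subseteq> E" "set y \<subseteq> E"
    then have "Q (rev y @ [f, e] @ rev x) \<longleftrightarrow> Q (rev y @ [g] @ rev x)"
      by (intro 5(1)) (auto simp: basic_prod_Opp)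
    then show "Q (rev (x @ [e, f] @ y)) \<longleftrightarrow> Q (rev (x @ [g] @ y))" by simp
  qed
  then show ?case by simp
qed

interpretation op: idem_presentation E "\<lambda>e. Opp (\<psi> e)" "Opp ` C" "\<lambda>e. Opp (\<gamma> e)"
  by (rule opposite)

lemma op_M: "op.M = Opp ` M"
proof -
  have "op.M = Opp ` \<mu> ` rev ` {w. set w \<subseteq> E}"
    unfolding op.M_def by (simp add: image_image prod_list_map_Opp)
  also have "rev ` {w. set w \<subseteq> E} = {w. set w \<subseteq> E}"
  proof (intro equalityI subsetI)
    fix w assume "w \<in> {w. set w \<subseteq> E}"
    then show "w \<in> rev ` {w. set w \<subseteq> E}" by (intro image_eqI[of _ _ "rev w"]) auto
  qed auto
  finally show ?thesis by (simp add: M_def)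
qed

lemma op_LL: "op.LL (Opp x) (Opp y) \<longleftrightarrow> RR x y" and op_RR: "op.RR (Opp x) (Opp y) \<longleftrightarrow> LL x y"
  by (auto simp: op.LL_def op.RR_def RR_def LL_def op_M)

lemma op_zone_at: "op.zone_at p d q \<longleftrightarrow> zone_at (rev q) d (rev p)"
  by (auto simp: op.zone_at_def zone_at_def prod_list_map_Opp op_LL op_RR)

lemma op_zone: "op.zone w \<longleftrightarrow> zone (rev w)"
proof
  assume "op.zone w"
  then obtain p d q where "w = p @ d # q" "op.zone_at p d q" unfolding op.zone_def by blast
  then have "rev w = rev q @ d # rev p" "zone_at (rev q) d (rev p)" by (auto simp: op_zone_at)
  then show "zone (rev w)" unfolding zone_def by blast
next
  assume "zone (rev w)"
  then obtain p d q where w: "rev w = p @ d # q" "zone_at p d q" unfolding zone_def by blast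
  then have "w = rev (p @ d # q)" by (metis rev_rev_ident)
  then have "w = rev q @ d # rev p" "op.zone_at (rev q) d (rev p)"
    using w by (auto simp: op_zone_at)
  then show "op.zone w" unfolding op.zone_def by blast
qed

lemma LL_generator:
  assumes "x \<in> M" "RR (\<gamma> e * x) (\<gamma> e)" "e \<in> E"
  shows "\<exists>r \<in> E. LL (\<gamma> e * x) (\<gamma> r)"
  using op.RR_generator[of "Opp x" e] assms by (simp add: op_M op_LL op_RR)

lemma zone_at_split_right:
  assumes "basic_prod E \<psi> e f g" "\<gamma> f * \<gamma> g = \<gamma> f" "zone_at p g q"
  shows "zone_at (p @ [e]) f q"
  using op.zone_at_split_left[of f e g "rev q" "rev p"] assms
  by (simp add: basic_prod_Opp op_zone_at)

lemma zone_at_join_right: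
  assumes "basic_prod E \<psi> e f g" "zone_at (p @ [e]) f q"
  shows "zone_at p g q"
  using op.zone_at_join_left[of f e g "rev q" "rev p"] assms
  by (simp add: basic_prod_Opp op_zone_at)

text \<open>Away from the seed the replacement changes no value. If \<open>g\<close> is the seed,
  \<open>basic_prod_cases\<close> tells which of \<open>e\<close> and \<open>f\<close> succeeds
  it.\<close>

lemma zone_split:
  assumes b: "basic_prod E \<psi> e f g" and "zone (x @ [g] @ y)"
  shows "zone (x @ [e, f] @ y)"
proof -
  note E = basic_prodD[OF b] and ef = \<gamma>_mult[OF b]
  obtain p d q where w: "x @ g # y = p @ d # q" and z: "zone_at p d q"
    using assms by (auto simp: zone_def)
  from w consider "x = p" "d = g" "q = y"
    | q' where "x = p @ d # q'" "q = q' @ g # y"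
    | p' where "p = x @ g # p'" "y = p' @ d # q"
    by (auto simp: append_eq_append_conv2 append_eq_Cons_conv Cons_eq_append_conv)
  then show ?thesis
  proof cases
    case 1
    then have "zone_at x e (f # y) \<or> zone_at (x @ [e]) f y"
      using basic_prod_cases[OF b] zone_at_split_left[OF b] zone_at_split_right[OF b] z by blast
    moreover have "x @ [e, f] @ y = x @ e # (f # y)" "x @ [e, f] @ y = (x @ [e]) @ f # y"
      by simp_all
    ultimately show ?thesis unfolding zone_def by blast
  next
    case 2
    then have "zone_at p d (q' @ [e, f] @ y)"
      using z E by (auto simp: zone_at_def mult.assoc[symmetric] ef[symmetric])
    moreover have "x @ [e, f] @ y = p @ d # (q' @ [e, f] @ y)" using 2 by simp
    ultimately show ?thesis unfolding zone_def by blast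
  next
    case 3
    then have "zone_at (x @ [e, f] @ p') d q"
      using z E by (auto simp: zone_at_def mult.assoc ef[symmetric])
    moreover have "x @ [e, f] @ y = (x @ [e, f] @ p') @ d # q" using 3 by simp
    ultimately show ?thesis unfolding zone_def by blast
  qed
qed

lemma zone_join:
  assumes b: "basic_prod E \<psi> e f g" and "zone (x @ [e, f] @ y)"
  shows "zone (x @ [g] @ y)"
proof -
  note E = basic_prodD[OF b] and ef = \<gamma>_mult[OF b]
  obtain p d q where w: "x @ e # f # y = p @ d # q" and z: "zone_at p d q"
    using assms by (auto simp: zone_def)
  from w consider "x = p" "d = e" "q = f # y" | "p = x @ [e]" "d = f" "q = y"
    | q' where "x = p @ d # q'" "q = q' @ e # f # y"
    | p' where "p = x @ e # f # p'" "y = p' @ d # q"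
    by (auto simp: append_eq_append_conv2 append_eq_Cons_conv Cons_eq_append_conv)
  then show ?thesis
  proof cases
    case 1
    then have "zone_at x g y" using zone_at_join_left[OF b] z by blast
    then show ?thesis unfolding zone_def by auto
  next
    case 2
    then have "zone_at x g y" using zone_at_join_right[OF b] z by blast
    then show ?thesis unfolding zone_def by auto
  next
    case 3
    then have "zone_at p d (q' @ [g] @ y)"
      using z E by (auto simp: zone_at_def mult.assoc[symmetric] ef[symmetric])
    moreover have "x @ [g] @ y = p @ d # (q' @ [g] @ y)" using 3 by simp
    ultimately show ?thesis unfolding zone_def by blast
  next
    case 4
    then have "zone_at (x @ [g] @ p') d q"
      using z E by (auto simp: zone_at_def mult.assoc ef[symmetric])
    moreover have "x @ [g] @ y = (x @ [g] @ p') @ d # q" using 4 by simp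
    ultimately show ?thesis unfolding zone_def by blast
  qed
qed

text \<open>The left zone absorbs \<open>f\<close>, since \<open>\<gamma> e * \<gamma> f\<close> is
  \<R>-related to \<open>\<gamma> e\<close>. If \<open>y\<close> is not a zone by itself, then
  \<open>\<gamma> f * \<mu> y\<close> is \<R>-related to \<open>\<gamma> f\<close> and
  \<open>y\<close> is absorbed too. Either way the number of zones does not grow.\<close>

lemma zone_join_across_left:
  assumes b: "basic_prod E \<psi> e f g" and "\<gamma> g * \<gamma> e = \<gamma> e" and "zone (x @ [e])" "zone (f # y)"
  shows "zone (x @ [g] @ y) \<or> zone (x @ [g]) \<and> zone y"
proof -
  note E = basic_prodD[OF b] and ef = \<gamma>_mult[OF b]
  have ge: "RR (\<gamma> g) (\<gamma> e)"
    unfolding RR_def using E assms(2) ef by (meson \<gamma>_in_M)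
  have "zone (x @ e # [f])" by (rule zone_append) (use assms E ge ef in auto)
  then have 1: "zone (x @ [g])" using zone_join[OF b, of x "[]"] by simp
  show ?thesis
  proof (cases "zone y")
    case False
    then have y: "RR (\<gamma> f * \<mu> y) (\<gamma> f)" "set y \<subseteq> E" using zone_Cons[OF assms(4)] False by blast+
    have "RR (\<gamma> e * (\<gamma> f * \<mu> y)) (\<gamma> e * \<gamma> f)" by (rule RR_mult[OF y(1)])
    also have "RR (\<gamma> e * \<gamma> f) (\<gamma> e)" using ge ef by simp
    finally have "RR (\<gamma> e * \<mu> (f # y)) (\<gamma> e)" by simp
    then have "zone (x @ e # f # y)" by (rule zone_append[OF assms(3)]) (use y E in auto)
    then show ?thesis using zone_join[OF b, of x y] by simp
  qed (use 1 in auto)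
qed

end

context idem_presentation
begin

text \<open>Repeated so that the dual of \<open>zone_join_across_left\<close> is available.\<close>

interpretation op: idem_presentation E "\<lambda>e. Opp (\<psi> e)" "Opp ` C" "\<lambda>e. Opp (\<gamma> e)"
  by (rule opposite)

lemma zone_join_across:
  assumes b: "basic_prod E \<psi> e f g" and "zone (x @ [e])" "zone (f # y)"
  shows "zone (x @ [g] @ y) \<or> zone (x @ [g]) \<and> zone y \<or> zone x \<and> zone ([g] @ y)"
  using basic_prod_cases[OF b]
proof
  assume "\<gamma> g * \<gamma> e = \<gamma> e"
  from zone_join_across_left[OF b this assms(2,3)] show ?thesis by blast
next
  assume "\<gamma> f * \<gamma> g = \<gamma> f"
  then have "zone (rev (rev y @ [g] @ rev x)) \<or> zone (rev (rev y @ [g])) \<and> zone (rev (rev x))"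
    using assms unfolding op_zone[symmetric]
    by (intro op.zone_join_across_left) (simp_all add: basic_prod_Opp op_zone)
  then show ?thesis by auto
qed

section \<open>Covering words by a bounded number of zones\<close>

definition cover :: "nat \<Rightarrow> 'a list \<Rightarrow> bool" where
  "cover n w \<longleftrightarrow> (\<exists>ws. concat ws = w \<and> length ws \<le> n \<and> (\<forall>z \<in> set ws. zone z))"

lemma cover_split:
  assumes b: "basic_prod E \<psi> e f g" and "cover n (x @ [g] @ y)"
  shows "cover n (x @ [e, f] @ y)"
proof -
  obtain ws where ws: "concat ws = x @ g # y" "length ws \<le> n" "\<forall>z \<in> set ws. zone z"
    using assms(2) by (auto simp: cover_def)
  then obtain ws1 z1 z2 ws2
    where d: "ws = ws1 @ (z1 @ g # z2) # ws2" "x = concat ws1 @ z1" "y = z2 @ concat ws2"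
    using concat_eq_append_Cons[OF ws(1)] by blast
  have "zone (z1 @ [e, f] @ z2)" using zone_split[OF b] ws d by simp
  then show ?thesis unfolding cover_def using ws d
    by (intro exI[of _ "ws1 @ (z1 @ [e, f] @ z2) # ws2"]) auto
qed

text \<open>If \<open>e\<close> and \<open>f\<close> lie in different zones, these may merge into
  one, which is why \<open>cover\<close> bounds the number of zones instead of fixing it.\<close>

lemma cover_join:
  assumes b: "basic_prod E \<psi> e f g" and "cover n (x @ [e, f] @ y)"
  shows "cover n (x @ [g] @ y)"
proof -
  obtain ws where ws: "concat ws = x @ e # f # y" "length ws \<le> n" "\<forall>z \<in> set ws. zone z"
    using assms(2) by (auto simp: cover_def)
  then obtain ws1 z1 z2 ws2
    where d: "ws = ws1 @ (z1 @ e # z2) # ws2" "x = concat ws1 @ z1" "f # y = z2 @ concat ws2"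
    using concat_eq_append_Cons[OF ws(1)] by blast
  show ?thesis
  proof (cases z2)
    case (Cons f' z3)
    then have "zone (z1 @ [g] @ z3)" using zone_join[OF b, of z1 z3] ws d by simp
    then show ?thesis unfolding cover_def using ws d Cons
      by (intro exI[of _ "ws1 @ (z1 @ [g] @ z3) # ws2"]) auto
  next
    case Nil
    \<comment> \<open>Here \<open>e\<close> ends its zone. Zones are nonempty, so \<open>f\<close>
      opens the next one.\<close>
    obtain z3 ws3 where z3: "ws2 = (f # z3) # ws3" "y = z3 @ concat ws3"
    proof (cases ws2)
      case (Cons z ws3)
      then have "zone z" using ws d by simp
      then obtain f' z3 where "z = f' # z3" by (cases z) (auto simp: zone_def)
      then show ?thesis using that Nil Cons d by simp
    qed (use Nil d in simp)
    have "zone (z1 @ [g] @ z3) \<or> zone (z1 @ [g]) \<and> zone z3 \<or> zone z1 \<and> zone ([g] @ z3)"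
      by (rule zone_join_across[OF b]) (use ws d Nil z3 in auto)
    then consider "zone (z1 @ [g] @ z3)" | "zone (z1 @ [g])" "zone z3" | "zone z1" "zone ([g] @ z3)"
      by blast
    then show ?thesis
    proof cases
      case 1
      then show ?thesis unfolding cover_def using ws d Nil z3
        by (intro exI[of _ "ws1 @ (z1 @ [g] @ z3) # ws3"]) auto
    next
      case 2
      then show ?thesis unfolding cover_def using ws d Nil z3
        by (intro exI[of _ "ws1 @ (z1 @ [g]) # z3 # ws3"]) auto
    next
      case 3
      then show ?thesis unfolding cover_def using ws d Nil z3
        by (intro exI[of _ "ws1 @ z1 # ([g] @ z3) # ws3"]) auto
    qed
  qed
qed

lemma cover_invariant:
  assumes "u \<in> words E" "v \<in> words E" "\<mu> u = \<mu> v"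
  shows "cover n u \<longleftrightarrow> cover n v"
  by (rule rewrite_invariant[OF _ assms]) (blast intro: cover_split cover_join)

lemma cover_length:
  assumes "set w \<subseteq> E"
  shows "cover (length w) w"
proof -
  have "zone [e]" if "e \<in> E" for e
    unfolding zone_def using that
    by (intro exI[of _ "[]"] exI[of _ e]) (simp add: zone_at_def)
  then show ?thesis unfolding cover_def using assms
    by (intro exI[of _ "map (\<lambda>e. [e]) w"]) auto
qed

section \<open>Units in the stabiliser\<close>

text \<open>There are finitely many classes of \<open>\<R>\<close> among the \<open>u\<^sup>k x\<close>, so \<open>u\<^sup>j x \<R> u\<^sup>k x\<close> for some
  \<open>j < k\<close>, and multiplication by \<open>q\<^sup>j\<close> brings this down to \<open>x \<in> u M\<close>.\<close>

lemma right_multiple: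
  assumes M: "u \<in> M" "q \<in> M" "x \<in> M" "e \<in> E" and x: "LL x (\<gamma> e)"
    and quu: "q * u * u = u" and qux: "q * u * x = x"
  shows "\<exists>z \<in> M. x = u * z"
proof -
  have qu: "q ^ k * u ^ Suc k = u" for k
  proof (induction k)
    case (Suc k)
    have "q ^ Suc k * u ^ Suc (Suc k) = q ^ k * (q * u * u) * u ^ k"
      by (simp only: power_Suc2[of q] power_Suc[of u] mult.assoc)
    also have "\<dots> = q ^ k * u ^ Suc k" unfolding quu by (simp add: mult.assoc)
    finally show ?case using Suc by simp
  qed simp
  have qx: "q ^ k * (u ^ k * x) = x" for k
  proof (induction k)
    case (Suc k)
    have "q ^ Suc k * (u ^ Suc k * x) = q * (q ^ k * u ^ Suc k) * x"
      by (simp only: power_Suc[of q] mult.assoc)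
    then show ?case by (simp only: qu qux)
  qed simp
  obtain t s where t: "t \<in> M" "t * x = \<gamma> e" "s \<in> M" "s * \<gamma> e = x" using x by (auto simp: LL_def)
  have xe: "x * \<gamma> e = x" using t \<gamma>_idem[OF M(4)] by (metis mult.assoc)
  have "\<exists>r \<in> E. RR (u ^ k * x) (\<gamma> r)" for k
  proof -
    \<comment> \<open>Since \<open>q ^ k\<close> cancels \<open>u ^ k\<close>, the element
      \<open>u ^ k * x\<close> stays in the \<L>-class of \<open>\<gamma> e\<close>, and
      \<open>RR_generator\<close> applies.\<close>
    have "t * q ^ k * (u ^ k * x) = \<gamma> e" using qx[of k] t by (simp add: mult.assoc)
    moreover have "u ^ k * s * \<gamma> e = u ^ k * x" using t by (simp add: mult.assoc)
    ultimately have "LL (u ^ k * x * \<gamma> e) (\<gamma> e)"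
      unfolding LL_def using M t xe by (metis mult.assoc mult_in_M power_in_M)
    from RR_generator[OF _ this M(4)] show ?thesis using M xe by (simp add: mult.assoc)
  qed
  then obtain r where r: "\<And>k. r k \<in> E" "\<And>k. RR (u ^ k * x) (\<gamma> (r k))" by metis
  have "\<not> inj r"
    using finite_imageD[of r UNIV] finite_subset[of "range r" E] finite_E r(1) by auto
  then obtain j k where jk: "j < k" "r j = r k"
    unfolding inj_def by (metis linorder_neqE_nat)
  have "RR (u ^ k * x) (u ^ j * x)"
    using r(2)[of j] r(2)[of k] jk(2) RR_trans RR_sym by metis
  then obtain z where z: "z \<in> M" "u ^ k * x * z = u ^ j * x" by (auto simp: RR_def)
  \<comment> \<open>As \<open>j < k\<close> is strict, a factor \<open>u\<close> survives the
    cancellation by \<open>q ^ j\<close>.\<close>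
  obtain i where i: "k = Suc j + i" using jk(1) less_iff_Suc_add by auto
  have "x = q ^ j * (u ^ k * x * z)" using qx z by simp
  also have "\<dots> = q ^ j * u ^ Suc j * (u ^ i * x * z)" by (simp only: i power_add mult.assoc)
  also have "\<dots> = u * (u ^ i * x * z)" by (simp only: qu)
  finally show ?thesis using M z by (meson mult_in_M power_in_M)
qed

text \<open>In the \<L>-order, \<open>\<gamma> g * \<gamma> f = \<gamma> g\<close> puts
  \<open>g\<close> below \<open>f\<close>. A minimal \<open>f\<close> is one with the fewest
  candidates below it; the last letter of \<open>w\<close> is a candidate.\<close>

lemma minimal_right_identity:
  assumes "w \<in> words E"
  obtains f where "f \<in> E" "\<mu> w * \<gamma> f = \<mu> w"
    "\<And>g. \<lbrakk>g \<in> E; \<mu> w * \<gamma> g = \<mu> w; \<gamma> g * \<gamma> f = \<gamma> g\<rbrakk> \<Longrightarrow> \<gamma> f * \<gamma> g = \<gamma> f"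
proof -
  define F where "F = {f \<in> E. \<mu> w * \<gamma> f = \<mu> w}"
  define D where "D f = {g \<in> F. \<gamma> g * \<gamma> f = \<gamma> g}" for f
  have fin: "finite (D f)" for f using finite_E by (simp add: D_def F_def)
  obtain w' l where w: "w = w' @ [l]" "l \<in> E"
    using assms by (cases w rule: rev_cases) (auto simp: words_def)
  then have "l \<in> F" by (simp add: F_def mult.assoc \<gamma>_idem)
  then obtain f where f: "f \<in> F" "\<And>g. g \<in> F \<Longrightarrow> card (D f) \<le> card (D g)"
    using ex_has_least_nat[of "\<lambda>f. f \<in> F" l "\<lambda>f. card (D f)"] by blast
  have "\<gamma> f * \<gamma> g = \<gamma> f" if "g \<in> F" "\<gamma> g * \<gamma> f = \<gamma> g" for g
  proof -
    have "D g \<subseteq> D f" using that(2) by (auto simp: D_def) (metis mult.assoc)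
    then have "D g = D f" using f(2)[OF that(1)] fin by (meson card_seteq)
    moreover have "f \<in> D f" using f(1) by (simp add: D_def F_def \<gamma>_idem)
    ultimately show ?thesis by (auto simp: D_def)
  qed
  then show thesis using that f(1) by (auto simp: F_def)
qed

text \<open>Provides the idempotent and the unit condition for
  \<open>schutzenberger_divisor\<close>.\<close>

theorem stabilizer_units:
  assumes w: "w \<in> words E"
  obtains f where "f \<in> E" "\<mu> w * \<gamma> f = \<mu> w"
    "\<And>v. \<lbrakk>v \<in> words E; \<gamma> f * \<mu> v = \<mu> v; \<mu> v * \<gamma> f = \<mu> v; \<mu> w * \<mu> v = \<mu> w\<rbrakk>
      \<Longrightarrow> LL (\<mu> v) (\<gamma> f) \<and> RR (\<mu> v) (\<gamma> f)"
proof -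
  obtain f where f: "f \<in> E" "\<mu> w * \<gamma> f = \<mu> w"
    and min: "\<And>g. \<lbrakk>g \<in> E; \<mu> w * \<gamma> g = \<mu> w; \<gamma> g * \<gamma> f = \<gamma> g\<rbrakk> \<Longrightarrow> \<gamma> f * \<gamma> g = \<gamma> f"
    using minimal_right_identity[OF w] by blast
  have "LL (\<mu> v) (\<gamma> f) \<and> RR (\<mu> v) (\<gamma> f)"
    if v: "v \<in> words E" and fv: "\<gamma> f * \<mu> v = \<mu> v" "\<mu> v * \<gamma> f = \<mu> v" and wv: "\<mu> w * \<mu> v = \<mu> w" for v
  proof -
    define u where "u = \<mu> v"
    have ne: "v \<noteq> []" and vE: "set v \<subseteq> E" and wE: "set w \<subseteq> E"
      using v w by (auto simp: words_def)
    have uM: "u \<in> M" using vE by (simp add: u_def)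
    \<comment> \<open>It suffices to find a generator in \<open>M * u\<close> that fixes
      \<open>\<mu> w\<close>: it lies below \<open>f\<close>, so minimality makes
      \<open>\<gamma> f\<close> a left multiple of it.\<close>
    have left: "\<exists>s \<in> M. s * u = \<gamma> f"
      if "g \<in> E" "\<mu> w * \<gamma> g = \<mu> w" "\<gamma> g = s * u" "s \<in> M" for g s
    proof -
      have "\<gamma> g * \<gamma> f = \<gamma> g" using that(3) fv(2) by (simp add: u_def mult.assoc)
      from min[OF that(1,2) this] have "\<gamma> f * s * u = \<gamma> f" using that(3) by (simp add: mult.assoc)
      then show ?thesis using f that by (meson \<gamma>_in_M mult_in_M)
    qed
    \<comment> \<open>One more than the possible number of zones, as
      \<open>concat_contains_square\<close> demands.\<close>
    define n where "n = Suc (length w)"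
    have pow: "\<mu> (w @ pow_word k v) = \<mu> w" for k
    proof (induction k)
      case (Suc k)
      have "\<mu> (w @ pow_word (Suc k) v) = \<mu> w * \<mu> v * \<mu> (pow_word k v)" by (simp add: mult.assoc)
      then show ?case using Suc wv by simp
    qed simp
    have square: "pow_word k (v @ v) = pow_word (2 * k) v" for k by (induction k) auto
    have powE: "set (pow_word k v) \<subseteq> E" for k using vE by (induction k) auto
    have "cover (length w) (w @ pow_word n (v @ v))"
    proof -
      have "cover (length w) (w @ pow_word n (v @ v)) \<longleftrightarrow> cover (length w) w"
      proof (rule cover_invariant)
        show "w @ pow_word n (v @ v) \<in> words E"
          using w powE[of "2 * n"] by (simp add: words_def square)
        show "\<mu> (w @ pow_word n (v @ v)) = \<mu> w" unfolding square by (rule pow)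
      qed (rule w)
      then show ?thesis using cover_length[OF wE] by simp
    qed
    then obtain ws where ws: "concat ws = w @ pow_word n (v @ v)" "length ws < n"
      and zones: "\<forall>z \<in> set ws. zone z" unfolding cover_def n_def by auto
    obtain ws1 z1 z2 ws2 i j where d: "ws = ws1 @ (z1 @ v @ v @ z2) # ws2"
      "concat ws1 @ z1 = w @ pow_word i v" "z2 @ concat ws2 = pow_word j v"
      using concat_contains_square[OF ne ws(2,1)] by blast
    have "zone (z1 @ v @ v @ z2)" using zones d by simp
    then obtain p e q where z: "z1 @ v @ v @ z2 = p @ e # q" "zone_at p e q"
      unfolding zone_def by blast
    have eE: "e \<in> E" "set p \<subseteq> E" "set q \<subseteq> E" using z(2) by (auto simp: zone_at_def)
    have "\<exists>s \<in> M. s * u = \<gamma> f"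
    proof -
      \<comment> \<open>Cut between the two copies of \<open>v\<close>: the seed lies on one side,
        so the copy on the other side belongs entirely to \<open>p\<close> or
        \<open>q\<close>.\<close>
      from z(1) have "(z1 @ v) @ (v @ z2) = p @ e # q" by simp
      from append_eq_append_conv2[THEN iffD1, OF this]
      obtain us where us: "z1 @ v = p @ us \<and> us @ v @ z2 = e # q \<or>
        (z1 @ v) @ us = p \<and> v @ z2 = us @ e # q" by blast
      consider q' where "z1 @ v = p @ e # q'" "q = q' @ v @ z2"
        | p' where "p = z1 @ v @ p'" "v @ z2 = p' @ e # q"
      proof (cases us)
        case Nil
        then show ?thesis using us that(2)[of "[]"] by auto
      next
        case (Cons e' q')
        then show ?thesis using us that by auto
      qed
      then show ?thesis
      proof cases
        case 1
        have q'M: "set q' \<subseteq> E" "set z2 \<subseteq> E" using 1 eE by auto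
        have "RR (\<gamma> e * (\<mu> q' * u) * \<mu> z2) (\<gamma> e)"
          using z(2) 1 by (simp add: zone_at_def u_def mult.assoc)
        then have "RR (\<gamma> e * (\<mu> q' * u)) (\<gamma> e)" by (rule RR_between) (use q'M uM in auto)
        from LL_generator[OF _ this eE(1)] q'M uM
        obtain g where g: "g \<in> E" "LL (\<gamma> e * (\<mu> q' * u)) (\<gamma> g)" by auto
        then obtain s t where s: "s \<in> M" "s * (\<gamma> e * (\<mu> q' * u)) = \<gamma> g"
          and t: "t \<in> M" "t * \<gamma> g = \<gamma> e * (\<mu> q' * u)" unfolding LL_def by blast
        \<comment> \<open>Appended copies of \<open>v\<close> do not change \<open>\<mu> w\<close>;
          cutting after the second one shows \<open>\<mu> w\<close> as a left multiple of
          \<open>\<gamma> g\<close>.\<close>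
        have "\<mu> w = \<mu> (concat ws1 @ z1 @ v @ v)"
        proof -
          have "\<mu> w = \<mu> (w @ pow_word i v) * \<mu> v * \<mu> v" using pow[of i] wv by simp
          also have "\<dots> = \<mu> ((concat ws1 @ z1) @ v @ v)" unfolding d(2) by (simp add: mult.assoc)
          finally show ?thesis by simp
        qed
        also have "\<dots> = \<mu> (concat ws1 @ (z1 @ v) @ v)" by simp
        also have "\<dots> = \<mu> (concat ws1 @ p) * (\<gamma> e * (\<mu> q' * u))"
          unfolding 1 by (simp add: u_def mult.assoc)
        also have "\<dots> = \<mu> (concat ws1 @ p) * t * \<gamma> g" by (simp add: t mult.assoc)
        finally have "\<mu> w = \<mu> (concat ws1 @ p) * t * \<gamma> g" .
        then have "\<mu> w * \<gamma> g = \<mu> w" using g(1) by (simp add: mult.assoc \<gamma>_idem)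
        moreover have "\<gamma> g = s * \<gamma> e * \<mu> q' * u" using s by (simp add: mult.assoc)
        ultimately show ?thesis using left[OF g(1)] s(1) eE q'M by simp
      next
        case 2
        \<comment> \<open>The seed may lie in \<open>z2\<close>, but everything from the second
          \<open>v\<close> on is a power of \<open>v\<close>, so it still sits in some copy of
          \<open>v\<close>.\<close>
        have "pow_word (Suc j) v = (v @ z2) @ concat ws2" using d(3) by simp
        also have "\<dots> = p' @ e # q @ concat ws2" unfolding 2(2) by simp
        finally have "pow_word (Suc j) v = p' @ e # q @ concat ws2" .
        from pow_word_eq_append_Cons[OF this] obtain k v1 v2 where v12: "v = v1 @ e # v2" "p' = pow_word k v @ v1"
          by blast
        have v12E: "set v1 \<subseteq> E" "set v2 \<subseteq> E" using v12 vE by auto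
        define x where "x = \<mu> v1 * \<gamma> e"
        have xM: "x \<in> M" using v12E eE by (simp add: x_def)
        have ux: "u = x * \<mu> v2" by (simp add: u_def x_def v12 mult.assoc)
        have "p = (z1 @ pow_word k v) @ v @ v1"
        proof -
          have "v @ pow_word k v = pow_word k v @ v" by (induction k) auto
          then show ?thesis using 2(1) v12(2) by (metis append.assoc)
        qed
        then have LLp: "LL (\<mu> (z1 @ pow_word k v) * (u * \<mu> v1 * \<gamma> e)) (\<gamma> e)"
          and z1E: "set z1 \<subseteq> E"
          using z(2) by (auto simp: zone_at_def u_def mult.assoc)
        have "LL (u * \<mu> v1 * \<gamma> e) (\<gamma> e)"
          by (rule LL_between[OF LLp])
            (use powE[of k] z1E v12E uM in \<open>simp_all del: set_concat prod_list.append map_append\<close>)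
        then have uxL: "LL (u * (\<mu> v1 * \<gamma> e)) (\<gamma> e)" by (simp add: mult.assoc)
        then have xL: "LL x (\<gamma> e)" unfolding x_def by (rule LL_between) (use v12E uM in auto)
        obtain t where t: "t \<in> M" "t * (u * x) = \<gamma> e" using uxL unfolding LL_def x_def by blast
        \<comment> \<open>\<open>q0\<close> undoes left multiplication by \<open>u\<close> on
          \<open>x\<close>, hence also on \<open>u = x * \<mu> v2\<close>, as
          \<open>right_multiple\<close> requires.\<close>
        define q0 where "q0 = \<mu> v1 * t"
        have q0M: "q0 \<in> M" using v12E t by (simp add: q0_def)
        have q0ux: "q0 * u * x = x" using t by (simp add: q0_def x_def mult.assoc)
        then have q0uu: "q0 * u * u = u" by (metis ux mult.assoc)
        obtain y where y: "y \<in> M" "x = u * y"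
          using right_multiple[OF uM q0M xM eE(1) xL q0uu q0ux] by blast
        \<comment> \<open>Because \<open>x = u * y\<close>, the factor \<open>y\<close> undoes
          \<open>\<mu> v2\<close> after the seed, and \<open>LL_generator\<close> becomes
          applicable.\<close>
        have "\<gamma> e * \<mu> v2 * y = t * (u * (x * \<mu> v2 * y))"
          using t(2) by (metis mult.assoc)
        also have "\<dots> = \<gamma> e" using y ux t by simp
        finally have "\<gamma> e * \<mu> v2 * y = \<gamma> e" .
        then have "RR (\<gamma> e * \<mu> v2) (\<gamma> e)" unfolding RR_def using y(1) \<mu>_in_M[OF v12E(2)] by blast
        then obtain g where g: "g \<in> E" "LL (\<gamma> e * \<mu> v2) (\<gamma> g)"
          using LL_generator[OF \<mu>_in_M[OF v12E(2)] _ eE(1)] by blast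
        then obtain s s' where s: "s \<in> M" "s * (\<gamma> e * \<mu> v2) = \<gamma> g"
          and s': "s' * \<gamma> g = \<gamma> e * \<mu> v2" unfolding LL_def by blast
        have "u * \<gamma> g = u"
        proof -
          have "u = \<mu> v1 * s' * \<gamma> g" using s' by (simp add: ux x_def mult.assoc)
          then show ?thesis using g(1) by (simp add: mult.assoc \<gamma>_idem)
        qed
        then have "\<mu> w * \<gamma> g = \<mu> w" using wv unfolding u_def by (metis mult.assoc)
        moreover have "\<gamma> g = s * t * u * u"
        proof -
          have "\<gamma> g = s * (t * (u * x) * \<mu> v2)" using s(2) t(2) by simp
          then show ?thesis by (simp add: mult.assoc ux[symmetric])
        qed
        ultimately show ?thesis using left[OF g(1)] s(1) t(1) uM by simp
      qed
    qed
    then obtain s where s: "s \<in> M" "s * u = \<gamma> f" by blast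
    \<comment> \<open>Right invertibility: \<open>right_multiple\<close> with
      \<open>\<gamma> f\<close> as \<open>x\<close> and the left inverse \<open>s\<close> as
      \<open>q\<close>.\<close>
    have "\<exists>z \<in> M. \<gamma> f = u * z"
    proof (rule right_multiple[OF uM s(1) _ f(1)])
      show "s * u * u = u" "s * u * \<gamma> f = \<gamma> f" using s fv f(1) by (simp_all add: u_def \<gamma>_idem)
    qed (use f in auto)
    then show ?thesis unfolding LL_def RR_def using s fv f(1) uM unfolding u_def by metis
  qed
  then show thesis using that f by blast
qed

end

section \<open>The Schutzenberger group as a divisor\<close>

context sgrp
begin

text \<open>An identity of \<open>S\<close> already yields \<open>a\<close>, and otherwise
  \<open>None\<close> does, so the case distinction in \<open>carrier1\<close> disappears.\<close>

lemma left_ideal1: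
  assumes "a \<in> carrier S"
  shows "{lmult1 S s a | s. s \<in> carrier1 S} = insert a ((\<lambda>t. t \<cdot> a) ` carrier S)"
proof -
  have "{lmult1 S s a | s. s \<in> carrier1 S} = (\<lambda>s. lmult1 S s a) ` carrier1 S" by auto
  also have "\<dots> = (\<lambda>t. t \<cdot> a) ` carrier S \<union> (if has_identity S then {} else {a})"
    by (auto simp: carrier1_def lmult1_def image_Un image_image)
  also have "\<dots> = insert a ((\<lambda>t. t \<cdot> a) ` carrier S)"
    using assms unfolding has_identity_def by (auto simp: image_iff) metis
  finally show ?thesis .
qed

lemma right_ideal1:
  assumes "a \<in> carrier S"
  shows "{rmult1 S a s | s. s \<in> carrier1 S} = insert a ((\<lambda>t. a \<cdot> t) ` carrier S)"
proof -
  have "{rmult1 S a s | s. s \<in> carrier1 S} = (\<lambda>s. rmult1 S a s) ` carrier1 S" by auto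
  also have "\<dots> = (\<lambda>t. a \<cdot> t) ` carrier S \<union> (if has_identity S then {} else {a})"
    by (auto simp: carrier1_def rmult1_def image_Un image_image)
  also have "\<dots> = insert a ((\<lambda>t. a \<cdot> t) ` carrier S)"
    using assms unfolding has_identity_def by (auto simp: image_iff) metis
  finally show ?thesis .
qed

lemma green_L_iff:
  "(a, b) \<in> green_L S \<longleftrightarrow> a \<in> carrier S \<and> b \<in> carrier S \<and>
    (a = b \<or> (\<exists>s \<in> carrier S. b = s \<cdot> a) \<and> (\<exists>t \<in> carrier S. a = t \<cdot> b))"
proof (cases "a \<in> carrier S \<and> b \<in> carrier S")
  case True
  then have ab: "a \<in> carrier S" "b \<in> carrier S" by auto
  have sub: "(\<lambda>t. t \<cdot> x) ` carrier S \<subseteq> (\<lambda>t. t \<cdot> y) ` carrier S"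
    if "y \<in> carrier S" "s \<in> carrier S" "x = s \<cdot> y" for x y s
  proof clarify
    fix t assume "t \<in> carrier S"
    then show "t \<cdot> x \<in> (\<lambda>t. t \<cdot> y) ` carrier S"
      using that by (intro image_eqI[of _ _ "t \<cdot> s"]) (auto simp: assoc closed)
  qed
  have "(a, b) \<in> green_L S \<longleftrightarrow>
      insert a ((\<lambda>t. t \<cdot> a) ` carrier S) = insert b ((\<lambda>t. t \<cdot> b) ` carrier S)"
    using ab by (simp add: green_L_def left_ideal1)
  also have "\<dots> \<longleftrightarrow> a = b \<or> (\<exists>s \<in> carrier S. b = s \<cdot> a) \<and> (\<exists>t \<in> carrier S. a = t \<cdot> b)"
  proof
    assume "insert a ((\<lambda>t. t \<cdot> a) ` carrier S) = insert b ((\<lambda>t. t \<cdot> b) ` carrier S)"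
    then have "a \<in> insert b ((\<lambda>t. t \<cdot> b) ` carrier S)" "b \<in> insert a ((\<lambda>t. t \<cdot> a) ` carrier S)"
      by blast+
    then show "a = b \<or> (\<exists>s \<in> carrier S. b = s \<cdot> a) \<and> (\<exists>t \<in> carrier S. a = t \<cdot> b)" by auto
  next
    assume "a = b \<or> (\<exists>s \<in> carrier S. b = s \<cdot> a) \<and> (\<exists>t \<in> carrier S. a = t \<cdot> b)"
    then show "insert a ((\<lambda>t. t \<cdot> a) ` carrier S) = insert b ((\<lambda>t. t \<cdot> b) ` carrier S)"
    proof (elim disjE conjE bexE)
      fix s t assume "s \<in> carrier S" "b = s \<cdot> a" "t \<in> carrier S" "a = t \<cdot> b"
      then show ?thesis using sub[of b t a] sub[of a s b] ab by blast
    qed simp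
  qed
  finally show ?thesis using ab by blast
qed (auto simp: green_L_def)

lemma green_R_iff:
  "(a, b) \<in> green_R S \<longleftrightarrow> a \<in> carrier S \<and> b \<in> carrier S \<and>
    (a = b \<or> (\<exists>s \<in> carrier S. b = a \<cdot> s) \<and> (\<exists>t \<in> carrier S. a = b \<cdot> t))"
proof (cases "a \<in> carrier S \<and> b \<in> carrier S")
  case True
  then have ab: "a \<in> carrier S" "b \<in> carrier S" by auto
  have sub: "(\<lambda>t. x \<cdot> t) ` carrier S \<subseteq> (\<lambda>t. y \<cdot> t) ` carrier S"
    if "y \<in> carrier S" "s \<in> carrier S" "x = y \<cdot> s" for x y s
  proof clarify
    fix t assume "t \<in> carrier S"
    then show "x \<cdot> t \<in> (\<lambda>t. y \<cdot> t) ` carrier S"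
      using that by (intro image_eqI[of _ _ "s \<cdot> t"]) (auto simp: assoc closed)
  qed
  have "(a, b) \<in> green_R S \<longleftrightarrow>
      insert a ((\<lambda>t. a \<cdot> t) ` carrier S) = insert b ((\<lambda>t. b \<cdot> t) ` carrier S)"
    using ab by (simp add: green_R_def right_ideal1)
  also have "\<dots> \<longleftrightarrow> a = b \<or> (\<exists>s \<in> carrier S. b = a \<cdot> s) \<and> (\<exists>t \<in> carrier S. a = b \<cdot> t)"
  proof
    assume "insert a ((\<lambda>t. a \<cdot> t) ` carrier S) = insert b ((\<lambda>t. b \<cdot> t) ` carrier S)"
    then have "a \<in> insert b ((\<lambda>t. b \<cdot> t) ` carrier S)" "b \<in> insert a ((\<lambda>t. a \<cdot> t) ` carrier S)"
      by blast+
    then show "a = b \<or> (\<exists>s \<in> carrier S. b = a \<cdot> s) \<and> (\<exists>t \<in> carrier S. a = b \<cdot> t)" by auto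
  next
    assume "a = b \<or> (\<exists>s \<in> carrier S. b = a \<cdot> s) \<and> (\<exists>t \<in> carrier S. a = b \<cdot> t)"
    then show "insert a ((\<lambda>t. a \<cdot> t) ` carrier S) = insert b ((\<lambda>t. b \<cdot> t) ` carrier S)"
    proof (elim disjE conjE bexE)
      fix s t assume "s \<in> carrier S" "b = a \<cdot> s" "t \<in> carrier S" "a = b \<cdot> t"
      then show ?thesis using sub[of b t a] sub[of a s b] ab by blast
    qed simp
  qed
  finally show ?thesis using ab by blast
qed (auto simp: green_R_def)

lemma green_L_sym: "(a, b) \<in> green_L S \<Longrightarrow> (b, a) \<in> green_L S"
  and green_L_trans: "\<lbrakk>(a, b) \<in> green_L S; (b, c) \<in> green_L S\<rbrakk> \<Longrightarrow> (a, c) \<in> green_L S"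
  and green_R_sym: "(a, b) \<in> green_R S \<Longrightarrow> (b, a) \<in> green_R S"
  and green_R_trans: "\<lbrakk>(a, b) \<in> green_R S; (b, c) \<in> green_R S\<rbrakk> \<Longrightarrow> (a, c) \<in> green_R S"
  by (auto simp: green_L_def green_R_def)

lemma green_L_mult:
  assumes "(a, b) \<in> green_L S" "c \<in> carrier S"
  shows "(a \<cdot> c, b \<cdot> c) \<in> green_L S"
  using assms unfolding green_L_iff by (auto simp: closed) (metis assoc closed)+

lemma equiv_green_H: "equiv (carrier S) (green_H S)"
proof (rule equivI)
  show "green_H S \<subseteq> carrier S \<times> carrier S" by (auto simp: green_H_def green_L_def)
  show "refl_on (carrier S) (green_H S)"
    by (auto simp: refl_on_def green_H_def green_L_def green_R_def)
  show "sym (green_H S)"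
    unfolding sym_def green_H_def using green_L_sym green_R_sym by blast
  show "trans (green_H S)"
    unfolding trans_def green_H_def using green_L_trans green_R_trans by blast
qed

text \<open>This is the unit group of the local monoid at \<open>f\<close>: Green multipliers,
  multiplied by \<open>f\<close> on both sides, become a left and a right inverse, which
  coincide.\<close>

lemma max_subgroup_carrier_iff:
  assumes f: "f \<in> carrier S" "f \<cdot> f = f"
  shows "x \<in> carrier (max_subgroup S f) \<longleftrightarrow> x \<in> carrier S \<and> f \<cdot> x = x \<and> x \<cdot> f = x \<and>
    (\<exists>y \<in> carrier S. f \<cdot> y = y \<and> y \<cdot> f = y \<and> x \<cdot> y = f \<and> y \<cdot> x = f)"
proof
  assume "x \<in> carrier (max_subgroup S f)"
  then have L: "(f, x) \<in> green_L S" and R: "(f, x) \<in> green_R S"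
    by (auto simp: max_subgroup_def green_H_def)
  have xS: "x \<in> carrier S" using L by (simp add: green_L_iff)
  obtain s t where st: "s \<in> carrier S" "t \<in> carrier S" "s \<cdot> f = x" "t \<cdot> x = f"
    using L f unfolding green_L_iff by metis
  obtain s' t' where st': "s' \<in> carrier S" "t' \<in> carrier S" "f \<cdot> s' = x" "x \<cdot> t' = f"
    using R f unfolding green_R_iff by metis
  have fx: "f \<cdot> x = x" using st'(1,3) f assoc by metis
  have xf: "x \<cdot> f = x" using st(1,3) f assoc by metis
  define y where "y = f \<cdot> t \<cdot> f"
  define z where "z = f \<cdot> t' \<cdot> f"
  have yS: "y \<in> carrier S" and zS: "z \<in> carrier S"
    using f st st' by (auto simp: y_def z_def closed)
  have yx: "y \<cdot> x = f" using f st(2,4) fx xS by (simp add: y_def assoc closed)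
  have xz: "x \<cdot> z = f"
  proof -
    have "x \<cdot> z = (x \<cdot> f) \<cdot> t' \<cdot> f" using f st'(2) xS by (simp add: z_def assoc closed)
    also have "\<dots> = f" using f xf st'(4) by simp
    finally show ?thesis .
  qed
  have fy: "f \<cdot> y = y" and yf: "y \<cdot> f = y"
    using f st(2) assoc closed unfolding y_def by metis+
  have fz: "f \<cdot> z = z" using f st'(2) assoc closed unfolding z_def by metis
  have "y = z" using yf xz yx fz assoc yS xS zS by metis
  then show "x \<in> carrier S \<and> f \<cdot> x = x \<and> x \<cdot> f = x \<and>
    (\<exists>y \<in> carrier S. f \<cdot> y = y \<and> y \<cdot> f = y \<and> x \<cdot> y = f \<and> y \<cdot> x = f)"
    using xS fx xf yS fy yf xz yx by auto
next
  assume "x \<in> carrier S \<and> f \<cdot> x = x \<and> x \<cdot> f = x \<and>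
    (\<exists>y \<in> carrier S. f \<cdot> y = y \<and> y \<cdot> f = y \<and> x \<cdot> y = f \<and> y \<cdot> x = f)"
  then have "(f, x) \<in> green_L S" "(f, x) \<in> green_R S"
    unfolding green_L_iff green_R_iff using f by metis+
  then show "x \<in> carrier (max_subgroup S f)" by (simp add: max_subgroup_def green_H_def)
qed

lemma group_max_subgroup:
  assumes f: "f \<in> carrier S" "f \<cdot> f = f"
  shows "group (max_subgroup S f)"
proof (rule groupI)
  note iff = max_subgroup_carrier_iff[OF f]
  have ops: "\<one>\<^bsub>max_subgroup S f\<^esub> = f" "x \<otimes>\<^bsub>max_subgroup S f\<^esub> y = x \<cdot> y" for x y
    by (simp_all add: max_subgroup_def)
  show "\<one>\<^bsub>max_subgroup S f\<^esub> \<in> carrier (max_subgroup S f)" unfolding iff ops using f by auto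
  fix x assume x: "x \<in> carrier (max_subgroup S f)"
  then obtain x' where x': "x' \<in> carrier S" "f \<cdot> x' = x'" "x' \<cdot> f = x'" "x \<cdot> x' = f" "x' \<cdot> x = f"
    unfolding iff by blast
  have xS: "x \<in> carrier S" "f \<cdot> x = x" "x \<cdot> f = x" using x unfolding iff by auto
  show "\<one>\<^bsub>max_subgroup S f\<^esub> \<otimes>\<^bsub>max_subgroup S f\<^esub> x = x" unfolding ops by (rule xS)
  have "x' \<in> carrier (max_subgroup S f)" unfolding iff using x' xS by auto
  then show "\<exists>y \<in> carrier (max_subgroup S f).
      y \<otimes>\<^bsub>max_subgroup S f\<^esub> x = \<one>\<^bsub>max_subgroup S f\<^esub>"
    unfolding ops using x' by blast
  fix y assume y: "y \<in> carrier (max_subgroup S f)"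
  then obtain y' where y': "y' \<in> carrier S" "f \<cdot> y' = y'" "y' \<cdot> f = y'" "y \<cdot> y' = f" "y' \<cdot> y = f"
    unfolding iff by blast
  have yS: "y \<in> carrier S" "f \<cdot> y = y" "y \<cdot> f = y" using y unfolding iff by auto
  have "(x \<cdot> y) \<cdot> (y' \<cdot> x') = f" "(y' \<cdot> x') \<cdot> (x \<cdot> y) = f"
    using xS yS x' y' f assoc closed by metis+
  moreover have "f \<cdot> (x \<cdot> y) = x \<cdot> y" "(x \<cdot> y) \<cdot> f = x \<cdot> y"
    "f \<cdot> (y' \<cdot> x') = y' \<cdot> x'" "(y' \<cdot> x') \<cdot> f = y' \<cdot> x'"
    using xS yS x' y' f assoc by metis+
  ultimately show "x \<otimes>\<^bsub>max_subgroup S f\<^esub> y \<in> carrier (max_subgroup S f)"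
    unfolding ops iff using xS yS x' y' closed by blast
  fix z assume "z \<in> carrier (max_subgroup S f)"
  then have "z \<in> carrier S" unfolding iff by auto
  then show "x \<otimes>\<^bsub>max_subgroup S f\<^esub> y \<otimes>\<^bsub>max_subgroup S f\<^esub> z =
      x \<otimes>\<^bsub>max_subgroup S f\<^esub> (y \<otimes>\<^bsub>max_subgroup S f\<^esub> z)"
    unfolding ops using xS yS by (simp add: assoc)
qed

theorem schutzenberger_divisor:
  assumes H: "H \<in> H_classes S" and a: "a \<in> H"
    and f: "f \<in> carrier S" "f \<cdot> f = f" and af: "a \<cdot> f = a"
    and units: "\<And>u. \<lbrakk>u \<in> carrier S; f \<cdot> u = u; u \<cdot> f = u; a \<cdot> u = a\<rbrakk> \<Longrightarrow> (f, u) \<in> green_H S"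
  shows "divisor (schutzenberger_group S H) (max_subgroup S f)"
proof -
  define G where "G = max_subgroup S f"
  define K where "K = {g \<in> carrier G. a \<cdot> g \<in> H}"
  define \<rho> where "\<rho> g = right_translation S H (Some g)" for g
  note iff = max_subgroup_carrier_iff[OF f, folded G_def]
  interpret G: group G unfolding G_def by (rule group_max_subgroup[OF f])
  have ops: "\<one>\<^bsub>G\<^esub> = f" "x \<otimes>\<^bsub>G\<^esub> y = x \<cdot> y" for x y by (simp_all add: G_def max_subgroup_def)
  have HC: "H \<subseteq> carrier S"
    using H in_quotient_imp_subset[OF equiv_green_H] by (auto simp: H_classes_def)
  have Hiff: "x \<in> H \<longleftrightarrow> (a, x) \<in> green_L S \<and> (a, x) \<in> green_R S" for x
  proof -
    have "H = green_H S `` {a}"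
      using H a unfolding H_classes_def quotient_def
      using equiv_class_eq[OF equiv_green_H] by blast
    then show ?thesis by (simp add: green_H_def)
  qed
  have aC: "a \<in> carrier S" using a HC by auto
  have hf: "h \<cdot> f = h" if "h \<in> H" for h
  proof -
    have "h = a \<or> (\<exists>s \<in> carrier S. h = s \<cdot> a)" using that unfolding Hiff green_L_iff by auto
    then show ?thesis using af assoc aC f(1) by auto
  qed
  \<comment> \<open>As \<open>g\<close> is invertible, \<open>h \<cdot> g\<close> is always
    \<R>-related to \<open>a\<close>; its \<L>-class does not depend on \<open>h\<close>.\<close>
  have translate: "h \<cdot> g \<in> H \<longleftrightarrow> (a, a \<cdot> g) \<in> green_L S" if g: "g \<in> carrier G" and h: "h \<in> H" for g h
  proof -
    obtain y where y: "y \<in> carrier S" "g \<in> carrier S" "g \<cdot> y = f" using g unfolding iff by auto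
    have "h \<cdot> g \<cdot> y = h" using y h HC hf assoc by auto
    then have "(h, h \<cdot> g) \<in> green_R S" unfolding green_R_iff using y h HC closed by (metis subsetD)
    then have R: "(a, h \<cdot> g) \<in> green_R S" using h green_R_trans unfolding Hiff by blast
    have "(a \<cdot> g, h \<cdot> g) \<in> green_L S" using green_L_mult y(2) h unfolding Hiff by blast
    then show ?thesis using R green_L_trans green_L_sym unfolding Hiff by blast
  qed
  have K: "g \<in> K \<longleftrightarrow> g \<in> carrier G \<and> (a, a \<cdot> g) \<in> green_L S" for g
    using translate[OF _ a] by (auto simp: K_def)
  have KH: "h \<cdot> g \<in> H" if "g \<in> K" "h \<in> H" for g h using translate that K by blast
  have subK: "subgroup K G"
  proof
    show "K \<subseteq> carrier G" by (auto simp: K_def)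
    show "\<one>\<^bsub>G\<^esub> \<in> K" using af a G.one_closed by (simp add: K_def ops)
    fix x assume x: "x \<in> K"
    then have xC: "x \<in> carrier G" "x \<in> carrier S" unfolding K iff by auto
    have iC: "inv\<^bsub>G\<^esub> x \<in> carrier G" "inv\<^bsub>G\<^esub> x \<in> carrier S" using xC G.inv_closed unfolding iff by auto
    have "x \<cdot> inv\<^bsub>G\<^esub> x = f" using G.r_inv[OF xC(1)] by (simp add: ops)
    then have "a \<cdot> x \<cdot> inv\<^bsub>G\<^esub> x = a" using aC xC iC af by (simp add: assoc)
    then have "(a \<cdot> inv\<^bsub>G\<^esub> x, a) \<in> green_L S"
      using green_L_mult[of a "a \<cdot> x" "inv\<^bsub>G\<^esub> x"] x iC unfolding K by auto
    then show "inv\<^bsub>G\<^esub> x \<in> K" using iC green_L_sym unfolding K by blast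
    fix y assume y: "y \<in> K"
    have "a \<cdot> x \<cdot> y \<in> H" using KH[OF y KH[OF x a]] .
    moreover have "y \<in> carrier S" "y \<in> carrier G" using y unfolding K iff by auto
    ultimately show "x \<otimes>\<^bsub>G\<^esub> y \<in> K"
      using xC aC G.m_closed[of x y] unfolding K_def ops by (simp add: assoc)
  qed
  define D where "D = schutzenberger_group S H"
  define GK where "GK = G\<lparr>carrier := K\<rparr>"
  interpret GK: group GK unfolding GK_def by (rule G.subgroup_imp_group[OF subK])
  have KS: "g \<in> carrier S" if "g \<in> K" for g using that unfolding K iff by auto
  have \<rho>_eq: "\<rho> g = (\<lambda>h \<in> H. h \<cdot> g)" for g by (simp add: \<rho>_def right_translation_def rmult1_def)
  have \<rho>_in: "\<rho> g \<in> carrier D" if "g \<in> K" for g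
  proof -
    have "Some g \<in> stab S H"
      using KH[OF that] KS[OF that] by (auto simp: stab_def carrier1_def rmult1_def)
    then show ?thesis by (simp add: D_def schutzenberger_group_def \<rho>_def)
  qed
  have hom: "\<rho> \<in> hom GK D"
  proof (rule homI)
    fix g h assume gh: "g \<in> carrier GK" "h \<in> carrier GK"
    then have "g \<in> K" "h \<in> K" by (auto simp: GK_def)
    then have "\<rho> (g \<cdot> h) = compose H (\<rho> h) (\<rho> g)"
      using KH KS HC by (auto simp: \<rho>_eq compose_def assoc fun_eq_iff subset_iff)
    then show "\<rho> (g \<otimes>\<^bsub>GK\<^esub> h) = \<rho> g \<otimes>\<^bsub>D\<^esub> \<rho> h"
      by (simp add: GK_def ops D_def schutzenberger_group_def)
  qed (use \<rho>_in in \<open>simp add: GK_def\<close>)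
  have \<rho>_one: "\<rho> f = \<one>\<^bsub>D\<^esub>"
    using hf by (auto simp: \<rho>_eq D_def schutzenberger_group_def fun_eq_iff)
  have surj: "\<rho> ` carrier GK = carrier D"
  proof (intro equalityI subsetI)
    fix r assume "r \<in> carrier D"
    then obtain s where s: "s \<in> stab S H" "r = right_translation S H s"
      by (auto simp: D_def schutzenberger_group_def)
    show "r \<in> \<rho> ` carrier GK"
    proof (cases s)
      case None
      have "r = \<rho> f" using hf by (auto simp: s None right_translation_def rmult1_def \<rho>_eq fun_eq_iff)
      moreover have "f \<in> carrier GK" using GK.one_closed by (simp add: GK_def ops)
      ultimately show ?thesis by blast
    next
      case (Some t)
      have tC: "t \<in> carrier S" and tH: "\<And>h. h \<in> H \<Longrightarrow> h \<cdot> t \<in> H"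
        using s(1) Some by (auto simp: stab_def carrier1_def rmult1_def split: if_splits)
      \<comment> \<open>\<open>f\<close> is a right identity on all of \<open>H\<close>, so moving
        \<open>t\<close> into the local monoid at \<open>f\<close> keeps the translation.\<close>
      define u where "u = f \<cdot> t \<cdot> f"
      have uC: "u \<in> carrier S" "f \<cdot> u = u" "u \<cdot> f = u"
        using f tC closed assoc unfolding u_def by metis+
      have hu: "h \<cdot> u = h \<cdot> t" if "h \<in> H" for h
      proof -
        have hC: "h \<in> carrier S" using that HC by auto
        have "h \<cdot> u = h \<cdot> f \<cdot> t \<cdot> f" unfolding u_def using hC f tC by (simp add: assoc closed)
        also have "\<dots> = h \<cdot> t" using hf[OF that] hf[OF tH[OF that]] by simp
        finally show ?thesis .
      qed
      have auH: "a \<cdot> u \<in> H" using hu a tH by simp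
      have "\<exists>y \<in> carrier S. a \<cdot> u \<cdot> y = a"
        using auH aC f(1) af unfolding Hiff green_R_iff by metis
      then obtain y0 where y0: "y0 \<in> carrier S" "a \<cdot> u \<cdot> y0 = a" by blast
      define y where "y = f \<cdot> y0 \<cdot> f"
      have yC: "y \<in> carrier S" "f \<cdot> y = y" "y \<cdot> f = y"
        using f y0(1) closed assoc unfolding y_def by metis+
      have auy: "a \<cdot> u \<cdot> y = a"
      proof -
        have "a \<cdot> u \<cdot> y = (a \<cdot> u \<cdot> f) \<cdot> y0 \<cdot> f"
          unfolding y_def using aC uC(1) f y0(1) by (simp add: assoc closed)
        also have "\<dots> = a" using hf[OF auH] y0(2) af by simp
        finally show ?thesis .
      qed
      \<comment> \<open>\<open>u\<close> itself need not fix \<open>a\<close>, but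
        \<open>u \<cdot> y\<close> and \<open>y \<cdot> u\<close> do; as units they make
        \<open>u\<close> invertible on both sides.\<close>
      have "(f, u \<cdot> y) \<in> green_H S"
      proof (rule units)
        show "u \<cdot> y \<in> carrier S" using yC uC closed by blast
        show "f \<cdot> (u \<cdot> y) = u \<cdot> y" using f yC uC assoc by metis
        show "(u \<cdot> y) \<cdot> f = u \<cdot> y" using f yC uC assoc by metis
        show "a \<cdot> (u \<cdot> y) = a" using auy aC uC yC by (simp add: assoc)
      qed
      moreover have "(f, y \<cdot> u) \<in> green_H S"
      proof (rule units)
        \<comment> \<open>Here the \<L>-relation enters: \<open>a\<close> is
          \<open>a \<cdot> u\<close> or a left multiple of it, and \<open>y \<cdot> u\<close> fixes
          \<open>a \<cdot> u\<close>.\<close>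
        have "a = a \<cdot> u \<or> (\<exists>z \<in> carrier S. a = z \<cdot> (a \<cdot> u))"
          using auH unfolding Hiff green_L_iff by metis
        moreover have "a \<cdot> u \<cdot> (y \<cdot> u) = a \<cdot> u"
          using auy aC uC(1) yC(1) by (metis assoc closed)
        ultimately show "a \<cdot> (y \<cdot> u) = a"
          using aC uC(1) yC(1) by (metis assoc closed)
        show "y \<cdot> u \<in> carrier S" using yC uC closed by blast
        show "f \<cdot> (y \<cdot> u) = y \<cdot> u" using f yC uC assoc by metis
        show "(y \<cdot> u) \<cdot> f = y \<cdot> u" using f yC uC assoc by metis
      qed
      ultimately have uy: "u \<cdot> y \<in> carrier G" "y \<cdot> u \<in> carrier G"
        by (auto simp: G_def max_subgroup_def)
      have "(f, u) \<in> green_L S"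
      proof -
        obtain z where z: "z \<in> carrier S" "z \<cdot> (y \<cdot> u) = f" using uy(2) unfolding iff by blast
        then have "f = z \<cdot> y \<cdot> u" using yC uC by (simp add: assoc)
        then show ?thesis unfolding green_L_iff using z uC yC f closed by metis
      qed
      moreover have "(f, u) \<in> green_R S"
      proof -
        obtain z where z: "z \<in> carrier S" "(u \<cdot> y) \<cdot> z = f" using uy(1) unfolding iff by blast
        then have "f = u \<cdot> (y \<cdot> z)" using yC uC by (simp add: assoc)
        then show ?thesis unfolding green_R_iff using z uC yC f closed by metis
      qed
      ultimately have "u \<in> K" using auH by (simp add: K_def G_def max_subgroup_def green_H_def)
      moreover have "r = \<rho> u"
        using hu by (auto simp: s Some right_translation_def rmult1_def \<rho>_eq fun_eq_iff)
      ultimately show ?thesis by (auto simp: GK_def)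
    qed
  qed (use \<rho>_in in \<open>auto simp: GK_def\<close>)
  \<comment> \<open>Since \<open>\<rho>\<close> is onto and maps \<open>f\<close> to the identity,
    this image group is \<open>D\<close> itself.\<close>
  have "group (D\<lparr>carrier := \<rho> ` carrier GK, one := \<rho> \<one>\<^bsub>GK\<^esub>\<rparr>)" by (rule GK.hom_imp_img_group[OF hom])
  moreover have "\<one>\<^bsub>GK\<^esub> = f" by (simp add: GK_def ops)
  ultimately have "group D" by (simp add: surj \<rho>_one)
  then interpret \<rho>: group_hom GK D \<rho> using hom by (simp add: group_hom_def group_hom_axioms_def GK.is_group)
  have "GK Mod kernel GK D \<rho> \<cong> D" using \<rho>.FactGroup_iso_set[OF surj] by (auto simp: is_iso_def)
  moreover have "group (GK Mod kernel GK D \<rho>)" by (rule normal.factorgroup_is_group[OF \<rho>.normal_kernel])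
  ultimately have "D \<cong> GK Mod kernel GK D \<rho>" by (rule group.iso_sym[rotated])
  then show ?thesis
    unfolding divisor_def D_def[symmetric] G_def[symmetric]
    using subK \<rho>.normal_kernel unfolding GK_def by blast
qed

end

section \<open>Free idempotent generated semigroups\<close>

lemma gen_cong_words: "(u, v) \<in> gen_cong A R \<Longrightarrow> u \<in> words A \<and> v \<in> words A"
  by (induction rule: gen_cong.induct) (auto simp: words_def)

lemma equiv_gen_cong: "equiv (words A) (gen_cong A R)"
proof (rule equivI)
  show "gen_cong A R \<subseteq> words A \<times> words A" using gen_cong_words by fast
  show "refl_on (words A) (gen_cong A R)" by (auto simp: refl_on_def intro: gen_cong.refl)
  show "sym (gen_cong A R)" by (auto simp: sym_def intro: gen_cong.sym)
  show "trans (gen_cong A R)" unfolding trans_def using gen_cong.trans by blast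
qed

lemma gen_cong_append:
  assumes "(u, u') \<in> gen_cong A R" "(v, v') \<in> gen_cong A R"
  shows "(u @ v, u' @ v') \<in> gen_cong A R"
proof (rule gen_cong.trans)
  show "(u @ v, u' @ v) \<in> gen_cong A R"
    using assms gen_cong_words by (blast intro: gen_cong.right)
  show "(u' @ v, u' @ v') \<in> gen_cong A R"
    using assms gen_cong_words by (blast intro: gen_cong.left)
qed

lemma presented_mult:
  assumes "u \<in> words A" "v \<in> words A"
  shows "gen_cong A R `` {u} \<cdot>\<^bsub>presented A R\<^esub> gen_cong A R `` {v} = gen_cong A R `` {u @ v}"
proof -
  have eq: "gen_cong A R `` {x @ y} = gen_cong A R `` {u @ v}"
    if "(u, x) \<in> gen_cong A R" "(v, y) \<in> gen_cong A R" for x y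
    using equiv_class_eq[OF equiv_gen_cong gen_cong_append[OF that]] by simp
  have uv: "u \<in> gen_cong A R `` {u}" "v \<in> gen_cong A R `` {v}"
    using assms by (auto intro: gen_cong.refl)
  have "(\<Union>x \<in> gen_cong A R `` {u}. \<Union>y \<in> gen_cong A R `` {v}. gen_cong A R `` {x @ y}) =
      (\<Union>x \<in> gen_cong A R `` {u}. \<Union>y \<in> gen_cong A R `` {v}. gen_cong A R `` {u @ v})"
    by (intro SUP_cong refl eq) simp_all
  also have "\<dots> = gen_cong A R `` {u @ v}" using uv by blast
  finally show ?thesis by (simp add: presented_def)
qed

lemma presented_carrier: "carrier (presented A R) = (\<lambda>u. gen_cong A R `` {u}) ` words A"
  by (auto simp: presented_def quotient_def)

lemma words_append [simp]: "\<lbrakk>u \<in> words A; v \<in> words A\<rbrakk> \<Longrightarrow> u @ v \<in> words A"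
  by (auto simp: words_def)

lemma sgrp_presented: "sgrp (presented A R)"
  by standard (auto simp: presented_carrier presented_mult)

text \<open>The faithful regular representation of the presented semigroup is restricted to the
  generators.\<close>

lemma presented_embedding:
  "\<exists>\<gamma> :: 'a \<Rightarrow> 'a list set option endo. \<forall>u \<in> words A. \<forall>v \<in> words A.
    prod_list (map \<gamma> u) = prod_list (map \<gamma> v) \<longleftrightarrow> (u, v) \<in> gen_cong A R"
proof -
  interpret sgrp "presented A R" by (rule sgrp_presented)
  obtain \<theta> :: "'a list set \<Rightarrow> 'a list set option endo"
    where inj: "inj_on \<theta> (carrier (presented A R))"
      and hom: "\<And>x y. \<lbrakk>x \<in> carrier (presented A R); y \<in> carrier (presented A R)\<rbrakk>
        \<Longrightarrow> \<theta> (x \<cdot>\<^bsub>presented A R\<^esub> y) = \<theta> x * \<theta> y"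
    using embedding by blast
  define \<gamma> where "\<gamma> e = \<theta> (gen_cong A R `` {[e]})" for e
  have eval: "w \<noteq> [] \<Longrightarrow> set w \<subseteq> A \<Longrightarrow> prod_list (map \<gamma> w) = \<theta> (gen_cong A R `` {w})" for w
  proof (induction w rule: list_nonempty_induct)
    case (single x)
    then show ?case by (simp add: \<gamma>_def)
  next
    case (cons x xs)
    then have "[x] \<in> words A" "xs \<in> words A" by (auto simp: words_def)
    then show ?case using cons presented_mult[of "[x]" A xs R] hom
      by (simp add: \<gamma>_def presented_carrier flip: hom)
  qed
  show ?thesis
  proof (intro exI[of _ \<gamma>] ballI)
    fix u v assume uv: "u \<in> words A" "v \<in> words A"
    then have "prod_list (map \<gamma> u) = prod_list (map \<gamma> v) \<longleftrightarrow>
        gen_cong A R `` {u} = gen_cong A R `` {v}"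
      using inj_onD[OF inj] by (auto simp: eval words_def presented_carrier)
    then show "prod_list (map \<gamma> u) = prod_list (map \<gamma> v) \<longleftrightarrow> (u, v) \<in> gen_cong A R"
      using eq_equiv_class_iff[OF equiv_gen_cong uv] by simp
  qed
qed

text \<open>An isomorphism onto some \<open>biordered_of S\<close> is followed by the regular
  representation of \<open>S\<close>; as that is faithful, idempotents and basic pairs carry
  over.\<close>

lemma biordered_set_realisation:
  assumes "biordered_set TYPE('s) E"
  shows "\<exists>(\<psi> :: 'a \<Rightarrow> 's option endo) C. (\<forall>x \<in> C. \<forall>y \<in> C. x * y \<in> C) \<and>
    bij_betw \<psi> (carrier E) {h \<in> C. h * h = h} \<and>
    (\<forall>e f g. basic_prod (carrier E) \<psi> e f g \<longleftrightarrow> basic_pair E e f \<and> pprod E e f = Some g)"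
proof -
  obtain S :: "'s sgrp" and \<phi> where S: "sgrp S" and \<phi>: "\<phi> \<in> partial_algebra_iso E (biordered_of S)"
    and pa: "is_partial_algebra E"
    using assms unfolding biordered_set_def by blast
  interpret sgrp S by (rule S)
  obtain \<theta> :: "'s \<Rightarrow> 's option endo"
    where inj: "inj_on \<theta> (carrier S)"
      and hom: "\<And>x y. \<lbrakk>x \<in> carrier S; y \<in> carrier S\<rbrakk> \<Longrightarrow> \<theta> (x \<cdot>\<^bsub>S\<^esub> y) = \<theta> x * \<theta> y"
    using embedding by blast
  have bij: "bij_betw \<phi> (carrier E) (idempotents S)"
    using \<phi> by (simp add: partial_algebra_iso_def biordered_of_def)
  then have \<phi>C: "\<phi> e \<in> carrier S" if "e \<in> carrier E" for e
    using that by (auto simp: bij_betw_def idempotents_def)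
  have \<phi>_inj: "\<phi> e = \<phi> f \<longleftrightarrow> e = f" if "e \<in> carrier E" "f \<in> carrier E" for e f
    using bij that by (auto simp: bij_betw_def inj_on_def)
  have \<theta>_inj: "\<theta> x = \<theta> y \<longleftrightarrow> x = y" if "x \<in> carrier S" "y \<in> carrier S" for x y
    using inj that by (auto simp: inj_on_def)
  define \<psi> where "\<psi> = \<theta> \<circ> \<phi>"
  show ?thesis
  proof (intro exI[of _ \<psi>] exI[of _ "\<theta> ` carrier S"] conjI allI)
    show "\<forall>x \<in> \<theta> ` carrier S. \<forall>y \<in> \<theta> ` carrier S. x * y \<in> \<theta> ` carrier S"
      by (auto simp: closed simp flip: hom)
    have "bij_betw \<theta> (idempotents S) (\<theta> ` idempotents S)"
      using inj by (auto simp: bij_betw_def idempotents_def inj_on_def)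
    moreover have "\<theta> ` idempotents S = {h \<in> \<theta> ` carrier S. h * h = h}"
      by (auto simp: idempotents_def closed \<theta>_inj simp flip: hom)
    ultimately show "bij_betw \<psi> (carrier E) {h \<in> \<theta> ` carrier S. h * h = h}"
      unfolding \<psi>_def using bij_betw_trans[OF bij] by simp
    fix e f g
    have prod: "map_option \<phi> (pprod E e f) =
        (if {\<phi> e \<cdot>\<^bsub>S\<^esub> \<phi> f, \<phi> f \<cdot>\<^bsub>S\<^esub> \<phi> e} \<inter> {\<phi> e, \<phi> f} \<noteq> {} then Some (\<phi> e \<cdot>\<^bsub>S\<^esub> \<phi> f) else None)"
      if "e \<in> carrier E" "f \<in> carrier E" for e f
      using \<phi> that by (simp add: partial_algebra_iso_def biordered_of_def)
    have pprod_carrier: "g \<in> carrier E" if "pprod E e f = Some g" "e \<in> carrier E" "f \<in> carrier E" for e f g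
      using pa that unfolding is_partial_algebra_def by blast
    show "basic_prod (carrier E) \<psi> e f g \<longleftrightarrow> basic_pair E e f \<and> pprod E e f = Some g"
    proof (cases "e \<in> carrier E \<and> f \<in> carrier E")
      case True
      then have ef: "e \<in> carrier E" "f \<in> carrier E" by auto
      define X where "X \<longleftrightarrow> {\<phi> e \<cdot>\<^bsub>S\<^esub> \<phi> f, \<phi> f \<cdot>\<^bsub>S\<^esub> \<phi> e} \<inter> {\<phi> e, \<phi> f} \<noteq> {}"
      have X': "X \<longleftrightarrow> {\<phi> f \<cdot>\<^bsub>S\<^esub> \<phi> e, \<phi> e \<cdot>\<^bsub>S\<^esub> \<phi> f} \<inter> {\<phi> f, \<phi> e} \<noteq> {}"
        unfolding X_def by (simp add: insert_commute)
      have p1: "map_option \<phi> (pprod E e f) = (if X then Some (\<phi> e \<cdot>\<^bsub>S\<^esub> \<phi> f) else None)"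
        unfolding X_def by (rule prod[OF ef])
      have p2: "map_option \<phi> (pprod E f e) = (if X then Some (\<phi> f \<cdot>\<^bsub>S\<^esub> \<phi> e) else None)"
        unfolding X' by (rule prod[OF ef(2,1)])
      \<comment> \<open>Values of \<open>pprod\<close> lie in the carrier, so injectivity of
        \<open>\<phi>\<close> recovers them from their images.\<close>
      have pprod_iff: "pprod E a b = Some h \<longleftrightarrow> X \<and> h \<in> carrier E \<and> \<phi> h = z"
        if p: "map_option \<phi> (pprod E a b) = (if X then Some z else None)"
          and ab: "a \<in> carrier E" "b \<in> carrier E" for a b h z
      proof (cases "pprod E a b")
        case (Some k)
        then have "k \<in> carrier E" "X" "\<phi> k = z"
          using pprod_carrier[OF Some ab] p by (auto split: if_splits)
        then show ?thesis using Some \<phi>_inj by auto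
      qed (use p in \<open>auto split: if_splits\<close>)
      note some = pprod_iff[OF p1 ef] and some' = pprod_iff[OF p2 ef(2,1)]
      have "basic_pair E e f \<longleftrightarrow> pprod E e f = Some e \<or> pprod E e f = Some f \<or>
          pprod E f e = Some e \<or> pprod E f e = Some f"
        using ef by (auto simp: basic_pair_def)
      then have bp: "basic_pair E e f \<longleftrightarrow> X"
        unfolding some some' using ef by (auto simp: X_def)
      have "basic_prod (carrier E) \<psi> e f g \<longleftrightarrow> X \<and> g \<in> carrier E \<and> \<phi> g = \<phi> e \<cdot>\<^bsub>S\<^esub> \<phi> f"
        using ef \<phi>C[OF ef(1)] \<phi>C[OF ef(2)] \<phi>C[of g] closed
        by (auto simp: basic_prod_def \<psi>_def X_def \<theta>_inj simp flip: hom)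
      then show ?thesis using bp some by blast
    qed (auto simp: basic_prod_def basic_pair_def)
  qed
qed

theorem corollary4p8:
  fixes E :: "'a partial_algebra" and H :: "'a list set set"
  assumes "biordered_set TYPE('s) E"
    and "finite (carrier E)"
    and "H \<in> H_classes (IG E)"
  shows "\<exists>e \<in> idempotents (IG E).
    divisor (schutzenberger_group (IG E) H) (max_subgroup (IG E) e)"
proof -
  define A where "A = carrier E"
  define R where "R = {([e, f], [g]) | e f g. basic_pair E e f \<and> pprod E e f = Some g}"
  define cls where "cls w = gen_cong A R `` {w}" for w
  have IG: "IG E = presented A R" by (simp add: IG_def A_def R_def)
  interpret sgrp "IG E" unfolding IG by (rule sgrp_presented)
  have carrier: "carrier (IG E) = cls ` words A" unfolding IG presented_carrier cls_def ..
  have mult: "cls u \<cdot>\<^bsub>IG E\<^esub> cls v = cls (u @ v)" if "u \<in> words A" "v \<in> words A" for u v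
    unfolding IG cls_def using that by (rule presented_mult)
  obtain \<psi> :: "'a \<Rightarrow> 's option endo" and C
    where C: "\<forall>x \<in> C. \<forall>y \<in> C. x * y \<in> C"
      and \<psi>: "bij_betw \<psi> A {h \<in> C. h * h = h}"
      and basic: "\<forall>e f g. basic_prod A \<psi> e f g \<longleftrightarrow> basic_pair E e f \<and> pprod E e f = Some g"
    using biordered_set_realisation[OF assms(1), folded A_def] by (elim exE conjE)
  obtain \<gamma> :: "'a \<Rightarrow> 'a list set option endo"
    where \<gamma>: "\<forall>u \<in> words A. \<forall>v \<in> words A.
      prod_list (map \<gamma> u) = prod_list (map \<gamma> v) \<longleftrightarrow> (u, v) \<in> gen_cong A R"
    using presented_embedding[of A R] by (elim exE)
  have R: "(u, v) \<in> R \<longleftrightarrow> (\<exists>e f g. u = [e, f] \<and> v = [g] \<and> basic_prod A \<psi> e f g)" for u v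
    by (auto simp: R_def basic)
  interpret idem_presentation A \<psi> C \<gamma>
  proof (unfold_locales, goal_cases)
    case (4 e f g)
    then have "[e, f] \<in> words A" "[g] \<in> words A" "([e, f], [g]) \<in> R"
      unfolding R by (auto simp: basic_prod_def words_def)
    then show ?case using \<gamma>[rule_format, of "[e, f]" "[g]"] by (simp add: gen_cong.base)
  next
    case (5 Q u v)
    \<comment> \<open>The congruence multiplies by words on both sides, so the induction carries
      arbitrary contexts, taken empty at the end.\<close>
    have "\<forall>x y. set x \<subseteq> A \<longrightarrow> set y \<subseteq> A \<longrightarrow> Q (x @ u @ y) = Q (x @ v @ y)"
      if "(u, v) \<in> gen_cong A R" for u v
      using that
    proof (induction rule: gen_cong.induct)
      case (base u v)
      then show ?case using 5(1) unfolding R by blast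
    next
      case (left u v w)
      show ?case
      proof (intro allI impI)
        fix x y assume "set x \<subseteq> A" "set y \<subseteq> A"
        then show "Q (x @ (w @ u) @ y) = Q (x @ (w @ v) @ y)"
          using left.IH[rule_format, of "x @ w" y] left.hyps(2) by (simp add: words_def)
      qed
    next
      case (right u v w)
      show ?case
      proof (intro allI impI)
        fix x y assume "set x \<subseteq> A" "set y \<subseteq> A"
        then show "Q (x @ (u @ w) @ y) = Q (x @ (v @ w) @ y)"
          using right.IH[rule_format, of x "w @ y"] right.hyps(2) by (simp add: words_def)
      qed
    qed simp_all
    from this[of u v, rule_format, of "[]" "[]"] show ?case using \<gamma> 5(2-4) by simp
  qed (use C \<psi> assms(2) in \<open>auto simp: A_def\<close>)
  have cls_eq: "cls u = cls v \<longleftrightarrow> \<mu> u = \<mu> v" if "u \<in> words A" "v \<in> words A" for u v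
    unfolding cls_def using eq_equiv_class_iff[OF equiv_gen_cong that] \<gamma> that by simp
  have "H \<noteq> {}" "H \<subseteq> carrier (IG E)"
    using assms(3) in_quotient_imp_non_empty[OF equiv_green_H]
      in_quotient_imp_subset[OF equiv_green_H] by (auto simp: H_classes_def)
  then obtain w where w: "w \<in> words A" "cls w \<in> H" unfolding carrier by blast
  obtain f where f: "f \<in> A" "\<mu> w * \<gamma> f = \<mu> w"
    and units: "\<And>v. \<lbrakk>v \<in> words A; \<gamma> f * \<mu> v = \<mu> v; \<mu> v * \<gamma> f = \<mu> v; \<mu> w * \<mu> v = \<mu> w\<rbrakk>
      \<Longrightarrow> LL (\<mu> v) (\<gamma> f) \<and> RR (\<mu> v) (\<gamma> f)"
    using stabilizer_units[OF w(1)] by blast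
  have fw: "[f] \<in> words A" using f(1) by (simp add: words_def)
  then have fC: "cls [f] \<in> carrier (IG E)" by (auto simp: carrier)
  have ff: "cls [f] \<cdot>\<^bsub>IG E\<^esub> cls [f] = cls [f]"
    using \<gamma>_idem[OF f(1)] unfolding mult[OF fw fw] cls_eq[OF words_append[OF fw fw] fw] by simp
  have "divisor (schutzenberger_group (IG E) H) (max_subgroup (IG E) (cls [f]))"
  proof (rule schutzenberger_divisor[OF assms(3) w(2) fC ff])
    show "cls w \<cdot>\<^bsub>IG E\<^esub> cls [f] = cls w" using w(1) fw f(2) by (simp add: mult cls_eq)
    fix u assume u: "u \<in> carrier (IG E)" "cls [f] \<cdot>\<^bsub>IG E\<^esub> u = u" "u \<cdot>\<^bsub>IG E\<^esub> cls [f] = u"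
      "cls w \<cdot>\<^bsub>IG E\<^esub> u = cls w"
    then obtain v where v: "v \<in> words A" "u = cls v" by (auto simp: carrier)
    have "cls ([f] @ v) = cls v" "cls (v @ [f]) = cls v" "cls (w @ v) = cls w"
      using u(2-4) unfolding v(2) by (simp_all only: mult fw v(1) w(1))
    then have "\<mu> ([f] @ v) = \<mu> v" "\<mu> (v @ [f]) = \<mu> v" "\<mu> (w @ v) = \<mu> w"
      by (simp_all only: cls_eq words_append fw v(1) w(1))
    then have "LL (\<mu> v) (\<gamma> f)" "RR (\<mu> v) (\<gamma> f)" using units[OF v(1)] by auto
    then obtain s t where st: "set s \<subseteq> A" "set t \<subseteq> A" "\<mu> s * \<mu> v = \<gamma> f" "\<mu> v * \<mu> t = \<gamma> f"
      unfolding LL_def RR_def M_def by blast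
    \<comment> \<open>\<open>s\<close> and \<open>t\<close> may be empty, since \<open>M\<close>
      contains \<open>1\<close>; padding with the idempotent \<open>f\<close> gives nonempty
      words.\<close>
    have fs: "[f] @ s \<in> words A" "t @ [f] \<in> words A" using st f(1) by (auto simp: words_def)
    have "\<mu> (([f] @ s) @ v) = \<mu> [f]" "\<mu> (v @ (t @ [f])) = \<mu> [f]"
      using st(3,4) \<gamma>_idem[OF f(1)] by (simp_all add: mult.assoc flip: mult.assoc[of "\<mu> v"])
    then have "cls [f] = cls ([f] @ s) \<cdot>\<^bsub>IG E\<^esub> u" "cls [f] = u \<cdot>\<^bsub>IG E\<^esub> cls (t @ [f])"
      unfolding v(2) mult[OF fs(1) v(1)] mult[OF v(1) fs(2)]
      by (simp_all only: cls_eq words_append fs fw v(1))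
    moreover have "cls ([f] @ s) \<in> carrier (IG E)" "cls (t @ [f]) \<in> carrier (IG E)"
      using fs by (auto simp: carrier)
    ultimately show "(cls [f], u) \<in> green_H (IG E)"
      unfolding green_H_def Int_iff green_L_iff green_R_iff using fC u(1-3) by metis
  qed
  moreover have "cls [f] \<in> idempotents (IG E)" using fC ff by (simp add: idempotents_def)
  ultimately show ?thesis by blast
qed

end
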